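(* Let $n\ge 2$. The (uniform) twisted conjugacy problem for the Houghton group $H_n$ is solvable: there is an algorithm which, given an automorphism $\phi\in\operatorname{Aut}(H_n)$ and two elements $a,b\in H_n$, decides whether there exists $x\in H_n$ with $(x^{-1})\phi\, a\, x=b$.
   Context: Let $\mathbb{N}=\{1,2,3,\dots\}$ and $X_n=\{1,\dots,n\}\times\mathbb{N}$; the set $\{i\}\times\mathbb{N}$ is the $i$-th ray. Permutations act on the right, written $(p)g$, and $gh$ means first $g$ then $h$. The Houghton group $H_n$ is the group of all bijections $g$ of $X_n$ for which there are $z_1(g),\dots,z_n(g)\in\mathbb{N}$ and $t_1(g),\dots,t_n(g)\in\mathbb{Z}$ with $(i,m)g=(i,m+t_i(g))$ for all $i$ and all $m\ge z_i(g)$. For $n\ge2$, $H_n$ is finitely generated, and elements are given as words in a fixed finite generating set. Each $\sigma\in S_n$ acts on $X_n$ by $(i,m)\sigma=(i\sigma,m)$; the subgroup $H_n\rtimes S_n$ of $\mathrm{Sym}(X_n)$ generated by $H_n$ and these permutations is finitely generated, equals the normaliser of $H_n$ in $\mathrm{Sym}(X_n)$, and $\rho\mapsto\phi_\rho$, $(h)\phi_\rho=\rho^{-1}h\rho$, is an isomorphism $H_n\rtimes S_n\to\operatorname{Aut}(H_n)$; automorphisms are given as $\phi_\rho$ with $\rho$ a word in a finite generating set of $H_n\rtimes S_n$. *)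

theory Defs
  imports Main "HOL-Library.Nat_Bijection" "HOL-Combinatorics.Permutations"
begin

text \<open>total_rec k f: f is a total recursive function of arity k (only its values on
  argument lists of length k matter). This is the standard closure of zero, successor and
  projections under composition, primitive recursion and regular (total) minimisation.\<close>

inductive total_rec :: "nat \<Rightarrow> (nat list \<Rightarrow> nat) \<Rightarrow> bool" where
  zero: "total_rec k (\<lambda>_. 0)"
| succ: "total_rec 1 (\<lambda>xs. Suc (hd xs))"
| proj: "i < k \<Longrightarrow> total_rec k (\<lambda>xs. xs ! i)"
| comp: "total_rec m g \<Longrightarrow> length fs = m \<Longrightarrow> (\<forall>f\<in>set fs. total_rec k f)
          \<Longrightarrow> total_rec k (\<lambda>xs. g (map (\<lambda>f. f xs) fs))"
| prec: "total_rec k g \<Longrightarrow> total_rec (k + 2) h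
          \<Longrightarrow> total_rec (Suc k)
               (\<lambda>xs. rec_nat (g (tl xs)) (\<lambda>y acc. h (y # acc # tl xs)) (hd xs))"
| mu:   "total_rec (Suc k) g \<Longrightarrow> (\<forall>xs. length xs = k \<longrightarrow> (\<exists>y. g (y # xs) = 0))
          \<Longrightarrow> total_rec k (\<lambda>xs. LEAST y. g (y # xs) = 0)"

text \<open>X_n = {1..n} \<times> \<nat> (with \<nat> = {1,2,...}). Permutations of X_n are represented as
  functions on nat \<times> nat that are the identity outside X_n. The right action (p)g is
  function application g p; the product gh (first g, then h) is h \<circ> g.\<close>

definition X :: "nat \<Rightarrow> (nat \<times> nat) set" where
  "X n = {(i, m). 1 \<le> i \<and> i \<le> n \<and> 1 \<le> m}"

definition SymX :: "nat \<Rightarrow> (nat \<times> nat \<Rightarrow> nat \<times> nat) set" where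
  "SymX n = {g. bij_betw g (X n) (X n) \<and> (\<forall>p. p \<notin> X n \<longrightarrow> g p = p)}"

definition houghton :: "nat \<Rightarrow> (nat \<times> nat \<Rightarrow> nat \<times> nat) set" where
  "houghton n = {g \<in> SymX n. \<exists>(z :: nat \<Rightarrow> nat) (t :: nat \<Rightarrow> int).
      (\<forall>i. 1 \<le> z i) \<and>
      (\<forall>i m. 1 \<le> i \<and> i \<le> n \<and> z i \<le> m \<longrightarrow> g (i, m) = (i, nat (int m + t i)))}"

definition ray_perm :: "nat \<Rightarrow> (nat \<Rightarrow> nat) \<Rightarrow> (nat \<times> nat \<Rightarrow> nat \<times> nat)" where
  "ray_perm n \<sigma> = (\<lambda>(i, m). if (i, m) \<in> X n then (\<sigma> i, m) else (i, m))"

inductive_set gen_by :: "('a \<Rightarrow> 'a) set \<Rightarrow> ('a \<Rightarrow> 'a) set" for A where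
  gen_id: "id \<in> gen_by A"
| gen_mult: "f \<in> gen_by A \<Longrightarrow> g \<in> A \<Longrightarrow> g \<circ> f \<in> gen_by A"
| gen_mult_inv: "f \<in> gen_by A \<Longrightarrow> g \<in> A \<Longrightarrow> inv g \<circ> f \<in> gen_by A"

text \<open>H_n \<rtimes> S_n: the subgroup of Sym(X_n) generated by H_n and the ray permutations.\<close>
definition houghton_ext :: "nat \<Rightarrow> (nat \<times> nat \<Rightarrow> nat \<times> nat) set" where
  "houghton_ext n = gen_by (houghton n \<union> {ray_perm n \<sigma> | \<sigma>. \<sigma> permutes {1..n}})"

definition letter :: "('a \<Rightarrow> 'a) list \<Rightarrow> nat \<Rightarrow> ('a \<Rightarrow> 'a)" where
  "letter gs k = (if even k then gs ! (k div 2) else inv (gs ! (k div 2)))"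

definition valid_word :: "('a \<Rightarrow> 'a) list \<Rightarrow> nat list \<Rightarrow> bool" where
  "valid_word gs w \<longleftrightarrow> (\<forall>k\<in>set w. k < 2 * length gs)"

fun eval_word :: "('a \<Rightarrow> 'a) list \<Rightarrow> nat list \<Rightarrow> ('a \<Rightarrow> 'a)" where
  "eval_word gs [] = id"
| "eval_word gs (k # w) = eval_word gs w \<circ> letter gs k"

definition generates :: "('a \<Rightarrow> 'a) list \<Rightarrow> ('a \<Rightarrow> 'a) set \<Rightarrow> bool" where
  "generates gs G \<longleftrightarrow> set gs \<subseteq> G \<and> (\<forall>g\<in>G. \<exists>w. valid_word gs w \<and> eval_word gs w = g)"

text \<open>Twisted conjugacy for \<phi>_\<rho>, (h)\<phi>_\<rho> = \<rho>^-1 h \<rho>: exists x \<in> H_n with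
  (x^-1)\<phi>_\<rho> a x = b, i.e. the product \<rho>^-1 x^-1 \<rho> a x equals b.\<close>
definition twisted_conj :: "nat \<Rightarrow> (nat \<times> nat \<Rightarrow> nat \<times> nat) \<Rightarrow> (nat \<times> nat \<Rightarrow> nat \<times> nat)
    \<Rightarrow> (nat \<times> nat \<Rightarrow> nat \<times> nat) \<Rightarrow> bool" where
  "twisted_conj n \<rho> a b \<longleftrightarrow> (\<exists>x\<in>houghton n. x \<circ> a \<circ> \<rho> \<circ> inv x \<circ> inv \<rho> = b)"

end

theory Submission
  imports Defs
begin

text \<open>Enumerate \<open>X_n\<close> by sending \<open>(i, m)\<close> to \<open>(m - 1) * n + (i - 1)\<close>. Elements of
  \<open>H_n \<rtimes> S_n\<close> become bijections of the naturals that eventually commute with \<open>q \<mapsto> q + n\<close>,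
  and those in \<open>H_n\<close> moreover eventually preserve residues modulo \<open>n\<close>. Twisted conjugacy of \<open>a\<close>
  and \<open>b\<close> asks for such a residue-preserving \<open>x\<close> with \<open>x \<circ> A = B \<circ> x\<close>, where \<open>A = a \<circ> \<rho>\<close> and
  \<open>B = b \<circ> \<rho>\<close>. If one exists, then there is one whose shifts and threshold are bounded explicitly in
  terms of \<open>A\<close> and \<open>B\<close>, and a table of its values up to the threshold can be found by exhaustive search.

  To bound \<open>x\<close>, note that \<open>A ^^ fact n\<close> translates each ray far out. On a ray with nonzero
  translation, \<open>x\<close> can be composed with a power of \<open>B ^^ fact n\<close> to shorten its shift; the exponent must
  be the same on rays joined by an orbit, but an orbit crosses the central region in boundedly many
  steps, so joined rays need nearly the same exponent. The remaining far orbits are finite,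
  and there \<open>x\<close> is rebuilt from a bijection between sets of orbit representatives.\<close>

section \<open>Recursive functions\<close>

text \<open>The obstacle is uniformity: a conjugator comes with a threshold \<open>Z\<close> that
  nothing bounds, and the search becomes finite only once \<open>Z\<close> is replaced by a number
  computable from the words. Facts about \<open>A\<close> and \<open>B\<close> are therefore proved
  from a threshold \<open>M\<close> that depends on \<open>n\<close> and a displacement bound
  \<open>K\<close> alone; the given \<open>x\<close> is evaluated arbitrarily far out and the
  outcome is carried back to \<open>M\<close>. Moving and static rays need opposite treatments. On a
  moving ray orbits run to infinity, so the shift of \<open>x\<close> far out forces its values
  already from \<open>M\<close> on, and what can be adjusted is a power of \<open>B\<close>; the
  result remains a bijective conjugator provided that the exponent is constant on orbits. On a
  static ray \<open>B ^^ fact n\<close> is the identity and shortens nothing, but there only periods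
  and visited residues matter, and far out \<open>A\<close> and \<open>B\<close> share both. A
  positive period that occurs beyond \<open>M\<close> belongs to infinitely many orbits, so a
  surplus of orbits near the centre can be swallowed. The exponent \<open>fact n\<close> is a
  multiple of every cycle length of the permutation of residues induced far out.\<close>

definition computable :: "nat \<Rightarrow> (nat list \<Rightarrow> nat) \<Rightarrow> bool" where
  "computable k f \<longleftrightarrow> (\<exists>f'. total_rec k f' \<and> (\<forall>xs. length xs = k \<longrightarrow> f' xs = f xs))"

text \<open>The rules of \<open>total_rec\<close> yield terms built from \<open>hd\<close>,
  \<open>tl\<close> and \<open>map\<close>. Since \<open>computable\<close> ignores lists of the
  wrong length, they can be traded here for the terms in which a predicate is naturally
  written.\<close>

lemma computable_cong:
  "computable k f \<Longrightarrow> (\<And>xs. length xs = k \<Longrightarrow> f xs = g xs) \<Longrightarrow> computable k g"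
  unfolding computable_def by fastforce

lemma computable_nth: "i < k \<Longrightarrow> computable k (\<lambda>xs. xs ! i)"
  unfolding computable_def using total_rec.proj by blast

lemma computable_compose:
  assumes "computable (length fs) g" "\<And>f. f \<in> set fs \<Longrightarrow> computable k f"
  shows "computable k (\<lambda>xs. g (map (\<lambda>f. f xs) fs))"
proof -
  obtain g' where g': "total_rec (length fs) g'" "\<And>xs. length xs = length fs \<Longrightarrow> g' xs = g xs"
    using assms(1) unfolding computable_def by blast
  obtain c where c: "\<And>f. f \<in> set fs \<Longrightarrow> total_rec k (c f) \<and> (\<forall>xs. length xs = k \<longrightarrow> c f xs = f xs)"
    using assms(2) unfolding computable_def by metis
  have "total_rec k (\<lambda>xs. g' (map (\<lambda>f. f xs) (map c fs)))"
    by (rule total_rec.comp[OF g'(1)]) (use c in auto)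
  moreover have "g' (map (\<lambda>f. f xs) (map c fs)) = g (map (\<lambda>f. f xs) fs)" if "length xs = k" for xs
  proof -
    have "map (\<lambda>f. f xs) (map c fs) = map (\<lambda>f. f xs) fs" using c that by auto
    then show ?thesis using g'(2) by (simp del: map_map)
  qed
  ultimately show ?thesis unfolding computable_def by blast
qed

definition computable1 :: "(nat \<Rightarrow> nat) \<Rightarrow> bool" where
  "computable1 F \<longleftrightarrow> computable 1 (\<lambda>xs. F (xs ! 0))"

definition computable2 :: "(nat \<Rightarrow> nat \<Rightarrow> nat) \<Rightarrow> bool" where
  "computable2 F \<longleftrightarrow> computable 2 (\<lambda>xs. F (xs ! 0) (xs ! 1))"

lemma computable1_app:
  assumes "computable1 F" "computable k a"
  shows "computable k (\<lambda>xs. F (a xs))"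
  using computable_compose[of "[a]" "\<lambda>xs. F (xs ! 0)" k] assms unfolding computable1_def by simp

lemma computable2_app:
  assumes "computable2 F" "computable k a" "computable k b"
  shows "computable k (\<lambda>xs. F (a xs) (b xs))"
  using computable_compose[of "[a, b]" "\<lambda>xs. F (xs ! 0) (xs ! 1)" k] assms
  unfolding computable2_def by (auto simp: numeral_2_eq_2)

lemma computable_Suc: "computable k a \<Longrightarrow> computable k (\<lambda>xs. Suc (a xs))"
proof (rule computable1_app[where F = Suc])
  have "total_rec 1 (\<lambda>xs. Suc (hd xs))" by (rule total_rec.succ)
  then show "computable1 Suc"
    unfolding computable1_def computable_def
    by (intro exI[of _ "\<lambda>xs. Suc (hd xs)"]) (auto simp: length_Suc_conv)
qed

lemma computable_const: "computable k (\<lambda>_. c)"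
proof (induction c)
  case 0
  then show ?case unfolding computable_def using total_rec.zero by blast
next
  case (Suc c)
  then show ?case by (rule computable_Suc)
qed

text \<open>A bounded quantifier puts its variable in front of the argument list, so under it an
  outer argument reads \<open>drop 1 ys ! i\<close>. Nested quantifiers nest the drops; three levels
  suffice for the search over tables.\<close>

lemma computable_drop: "m + i < k \<Longrightarrow> computable k (\<lambda>xs. drop m xs ! i)"
  by (rule computable_cong[OF computable_nth[of "m + i"]]) (auto simp: nth_drop)

lemma computable_drop2: "m + m' + i < k \<Longrightarrow> computable k (\<lambda>xs. drop m (drop m' xs) ! i)"
  by (rule computable_cong[OF computable_nth[of "m + m' + i"]]) (auto simp: nth_drop add_ac)

lemma computable_drop3: "m + m' + m'' + i < k \<Longrightarrow> computable k (\<lambda>xs. drop m (drop m' (drop m'' xs)) ! i)"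
  by (rule computable_cong[OF computable_nth[of "m + m' + m'' + i"]]) (auto simp: nth_drop add_ac)

lemma computable_rec:
  assumes b: "computable k b" and st: "computable (k + 2) (\<lambda>ys. st (ys ! 0) (ys ! 1) (drop 2 ys))"
    and c: "computable k c"
  shows "computable k (\<lambda>xs. rec_nat (b xs) (\<lambda>y acc. st y acc xs) (c xs))"
proof -
  obtain b' where b': "total_rec k b'" "\<And>xs. length xs = k \<Longrightarrow> b' xs = b xs"
    using b unfolding computable_def by blast
  obtain st' where st': "total_rec (k + 2) st'"
      "\<And>xs. length xs = k + 2 \<Longrightarrow> st' xs = st (xs ! 0) (xs ! 1) (drop 2 xs)"
    using st unfolding computable_def by blast
  let ?r = "\<lambda>xs. rec_nat (b' (tl xs)) (\<lambda>y acc. st' (y # acc # tl xs)) (hd xs)"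
  have r: "computable (Suc k) (\<lambda>xs. rec_nat (b (tl xs)) (\<lambda>y acc. st y acc (tl xs)) (hd xs))"
    unfolding computable_def
  proof (intro exI[of _ ?r] conjI allI impI)
    show "total_rec (Suc k) ?r" by (rule total_rec.prec[OF b'(1) st'(1)])
    fix xs :: "nat list" assume l: "length xs = Suc k"
    have "st' (y # acc # tl xs) = st y acc (tl xs)" for y acc
      using st'(2)[of "y # acc # tl xs"] l by (simp add: numeral_2_eq_2)
    then show "?r xs = rec_nat (b (tl xs)) (\<lambda>y acc. st y acc (tl xs)) (hd xs)"
      using b'(2)[of "tl xs"] l by simp
  qed
  \<comment> \<open>\<open>prec\<close> recurses on the head of its list. Putting \<open>c\<close>
    there and copying all arguments behind it makes the recursion bound a computed value and keeps
    \<open>xs\<close> available as parameters.\<close>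
  let ?fs = "c # map (\<lambda>i xs. xs ! i) [0..<k]"
  have "computable k (\<lambda>xs. (\<lambda>xs. rec_nat (b (tl xs)) (\<lambda>y acc. st y acc (tl xs)) (hd xs)) (map (\<lambda>f. f xs) ?fs))"
    by (rule computable_compose) (use r c computable_nth in auto)
  then show ?thesis
  proof (rule computable_cong)
    fix xs :: "nat list" assume "length xs = k"
    then have "map (\<lambda>i. xs ! i) [0..<k] = xs" using map_nth by blast
    then show "(\<lambda>xs. rec_nat (b (tl xs)) (\<lambda>y acc. st y acc (tl xs)) (hd xs)) (map (\<lambda>f. f xs) ?fs)
       = rec_nat (b xs) (\<lambda>y acc. st y acc xs) (c xs)" by (simp add: comp_def)
  qed
qed

lemma computable_Least:
  assumes g: "computable (Suc k) (\<lambda>ys. g (ys ! 0) (drop 1 ys))"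
    and ex: "\<And>xs. length xs = k \<Longrightarrow> \<exists>y. g y xs = 0"
  shows "computable k (\<lambda>xs. LEAST y. g y xs = 0)"
proof -
  obtain g' where g': "total_rec (Suc k) g'"
      "\<And>xs. length xs = Suc k \<Longrightarrow> g' xs = g (xs ! 0) (drop 1 xs)"
    using g unfolding computable_def by blast
  have eq: "g' (y # xs) = g y xs" if "length xs = k" for y xs using g'(2)[of "y # xs"] that by simp
  have "total_rec k (\<lambda>xs. LEAST y. g' (y # xs) = 0)"
    by (rule total_rec.mu[OF g'(1)]) (use ex eq in auto)
  then show ?thesis unfolding computable_def using eq by fastforce
qed

section \<open>Arithmetic by primitive recursion\<close>

lemma computable_pred: "computable k a \<Longrightarrow> computable k (\<lambda>xs. a xs - 1)"
proof -
  assume a: "computable k a"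
  have "a xs - 1 = rec_nat 0 (\<lambda>y acc. y) (a xs)" for xs by (cases "a xs") auto
  then show ?thesis
    using computable_rec[of k "\<lambda>_. 0" "\<lambda>y acc xs. y" a] a computable_const computable_nth[of 0] by simp
qed

lemma computable_add:
  assumes "computable k a" "computable k b" shows "computable k (\<lambda>xs. a xs + b xs)"
proof -
  have e: "rec_nat u (\<lambda>y acc. Suc acc) v = u + v" for u v :: nat by (induction v) auto
  show ?thesis
    using computable_rec[of k a "\<lambda>y acc xs. Suc acc" b] assms e
      computable_Suc[OF computable_nth[of 1 "k + 2"]] by simp
qed

lemma computable_diff:
  assumes "computable k a" "computable k b" shows "computable k (\<lambda>xs. a xs - b xs)"
proof -
  have e: "rec_nat u (\<lambda>y acc. acc - Suc 0) v = u - v" for u v :: nat by (induction v) auto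
  show ?thesis
    using computable_rec[of k a "\<lambda>y acc xs. acc - 1" b] assms e
      computable_pred[OF computable_nth[of 1 "k + 2"]] by simp
qed

lemma computable_weaken: "computable k a \<Longrightarrow> computable (Suc k) (\<lambda>ys. a (drop 1 ys))"
proof -
  assume a: "computable k a"
  have "computable (Suc k) (\<lambda>xs. a (map (\<lambda>f. f xs) (map (\<lambda>i xs. xs ! Suc i) [0..<k])))"
    by (rule computable_compose) (use a computable_nth in auto)
  then show ?thesis
  proof (rule computable_cong)
    fix xs :: "nat list" assume "length xs = Suc k"
    then have "map (\<lambda>i. xs ! Suc i) [0..<k] = drop 1 xs"
      by (intro nth_equalityI) auto
    then show "a (map (\<lambda>f. f xs) (map (\<lambda>i xs. xs ! Suc i) [0..<k])) = a (drop 1 xs)"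
      by (simp add: comp_def)
  qed
qed

lemma computable_weaken2: "computable k a \<Longrightarrow> computable (k + 2) (\<lambda>ys. a (drop 2 ys))"
  using computable_weaken[OF computable_weaken] by (simp add: numeral_2_eq_2)

lemma computable_mult:
  assumes "computable k a" "computable k b" shows "computable k (\<lambda>xs. a xs * b xs)"
proof -
  have e: "rec_nat 0 (\<lambda>y acc. acc + u) v = u * v" for u v :: nat by (induction v) auto
  show ?thesis
    using computable_rec[of k "\<lambda>_. 0" "\<lambda>y acc xs. acc + a xs" b] assms e computable_const
      computable_add[OF computable_nth[of 1 "k + 2"] computable_weaken2[OF assms(1)]] by simp
qed

lemma computable_power:
  assumes "computable k a" "computable k b" shows "computable k (\<lambda>xs. a xs ^ b xs)"
proof -
  have e: "rec_nat 1 (\<lambda>y acc. acc * u) v = u ^ v" for u v :: nat by (induction v) auto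
  show ?thesis
    using computable_rec[of k "\<lambda>_. 1" "\<lambda>y acc xs. acc * a xs" b] assms e computable_const
      computable_mult[OF computable_nth[of 1 "k + 2"] computable_weaken2[OF assms(1)]] by simp
qed

section \<open>Decidable predicates and bounded quantifiers\<close>

definition decidable :: "nat \<Rightarrow> (nat list \<Rightarrow> bool) \<Rightarrow> bool" where
  "decidable k P \<longleftrightarrow> computable k (\<lambda>xs. of_bool (P xs))"

lemma decidable_not: "decidable k P \<Longrightarrow> decidable k (\<lambda>xs. \<not> P xs)"
  unfolding decidable_def
  by (rule computable_cong[OF computable_diff[OF computable_const[of k 1], of "\<lambda>xs. of_bool (P xs)"]]) auto

lemma decidable_conj: "decidable k P \<Longrightarrow> decidable k Q \<Longrightarrow> decidable k (\<lambda>xs. P xs \<and> Q xs)"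
  unfolding decidable_def using computable_mult by (simp add: of_bool_conj)

lemma decidable_disj: "decidable k P \<Longrightarrow> decidable k Q \<Longrightarrow> decidable k (\<lambda>xs. P xs \<or> Q xs)"
  using decidable_not[OF decidable_conj[OF decidable_not decidable_not]] by simp

lemma decidable_imp: "decidable k P \<Longrightarrow> decidable k Q \<Longrightarrow> decidable k (\<lambda>xs. P xs \<longrightarrow> Q xs)"
  unfolding imp_conv_disj by (intro decidable_disj decidable_not)

lemma decidable_less:
  assumes "computable k a" "computable k b" shows "decidable k (\<lambda>xs. a xs < b xs)"
proof -
  have "of_bool (u < v) = 1 - (1 - (v - u))" for u v :: nat by simp
  then show ?thesis unfolding decidable_def
    by (simp only:) (intro computable_diff computable_const assms)
qed

lemma decidable_le:
  assumes "computable k a" "computable k b" shows "decidable k (\<lambda>xs. a xs \<le> b xs)"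
  using decidable_less[OF assms(1) computable_Suc[OF assms(2)]] by (simp add: less_Suc_eq_le)

lemma decidable_eq:
  assumes "computable k a" "computable k b" shows "decidable k (\<lambda>xs. a xs = b xs)"
  using decidable_conj[OF decidable_le[OF assms] decidable_le[OF assms(2,1)]]
  by (simp add: order_antisym_conv eq_iff)

lemma computable_if:
  assumes "decidable k P" "computable k a" "computable k b"
  shows "computable k (\<lambda>xs. if P xs then a xs else b xs)"
proof -
  have "computable k (\<lambda>xs. of_bool (P xs) * a xs + of_bool (\<not> P xs) * b xs)"
    using assms decidable_not[OF assms(1)] unfolding decidable_def
    by (intro computable_add computable_mult)
  then show ?thesis by (rule computable_cong) auto
qed

lemma decidable_ball:
  assumes c: "computable k c" and P: "decidable (Suc k) (\<lambda>ys. P (ys ! 0) (drop 1 ys))"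
  shows "decidable k (\<lambda>xs. \<forall>y<c xs. P y xs)"
proof -
  have e: "rec_nat 1 (\<lambda>y acc. acc * of_bool (Q y)) v = (of_bool (\<forall>y<v. Q y) :: nat)" for v Q
    by (induction v) (auto simp: less_Suc_eq)
  \<comment> \<open>The recursion inserts its accumulator behind the quantified variable, whereas
    \<open>P\<close> expects the remaining arguments there; the composition below skips the
    accumulator.\<close>
  have "computable (k + 2) (\<lambda>xs. (of_bool (P (xs ! 0) (drop 2 xs)) :: nat))"
  proof -
    have "computable (k + 2) (\<lambda>xs. (\<lambda>ys. (of_bool (P (ys ! 0) (drop 1 ys)) :: nat))
        (map (\<lambda>f. f xs) ((\<lambda>xs. xs ! 0) # map (\<lambda>i xs. xs ! (i + 2)) [0..<k])))"
      by (rule computable_compose) (use P computable_nth in \<open>auto simp: decidable_def\<close>)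
    then show ?thesis
    proof (rule computable_cong)
      fix xs :: "nat list" assume "length xs = k + 2"
      then have "map (\<lambda>i. xs ! (i + 2)) [0..<k] = drop 2 xs"
        by (intro nth_equalityI) auto
      then show "(\<lambda>ys. (of_bool (P (ys ! 0) (drop 1 ys)) :: nat))
        (map (\<lambda>f. f xs) ((\<lambda>xs. xs ! 0) # map (\<lambda>i xs. xs ! (i + 2)) [0..<k])) = of_bool (P (xs ! 0) (drop 2 xs))"
        by (simp add: comp_def)
    qed
  qed
  then have "computable (k + 2) (\<lambda>ys. ys ! 1 * (of_bool (P (ys ! 0) (drop 2 ys)) :: nat))"
    by (intro computable_mult computable_nth) auto
  from computable_rec[of k "\<lambda>_. 1" "\<lambda>y acc xs. acc * of_bool (P y xs)" c, OF computable_const this c] e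
  show ?thesis unfolding decidable_def by simp
qed

lemma decidable_bex:
  assumes "computable k c" "decidable (Suc k) (\<lambda>ys. P (ys ! 0) (drop 1 ys))"
  shows "decidable k (\<lambda>xs. \<exists>y<c xs. P y xs)"
  using decidable_not[OF decidable_ball[OF assms(1) decidable_not[OF assms(2)]]] by simp

lemma computable_Least_dec:
  assumes P: "decidable (Suc k) (\<lambda>ys. P (ys ! 0) (drop 1 ys))"
    and ex: "\<And>xs. length xs = k \<Longrightarrow> \<exists>y. P y xs"
  shows "computable k (\<lambda>xs. LEAST y. P y xs)"
  using computable_Least[of k "\<lambda>y xs. of_bool (\<not> P y xs)"] decidable_not[OF P] ex
  unfolding decidable_def by simp

text \<open>Minimisation must succeed on every input. The disjunct for a zero divisor ensures this
  and yields 0, which agrees with \<open>u div 0\<close>.\<close>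

lemma computable2_div: "computable2 (div)"
proof -
  have d: "decidable (Suc 2) (\<lambda>ys. drop 1 ys ! 1 = 0 \<or> drop 1 ys ! 0 < Suc (ys ! 0) * drop 1 ys ! 1)"
    by (intro decidable_disj decidable_eq decidable_less computable_mult computable_Suc
        computable_drop computable_nth computable_const) auto
  have "computable 2 (\<lambda>xs. LEAST y. xs ! 1 = 0 \<or> xs ! 0 < Suc y * xs ! 1)"
    by (rule computable_Least_dec[OF d]) (metis div_less_iff_less_mult lessI neq0_conv)
  moreover have "(LEAST y. v = 0 \<or> u < Suc y * v) = u div v" for u v :: nat
  proof (cases "v = 0")
    case False
    show ?thesis
    proof (rule Least_equality)
      show "v = 0 \<or> u < Suc (u div v) * v" using False dividend_less_div_times by fastforce
      show "u div v \<le> y" if "v = 0 \<or> u < Suc y * v" for y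
        using that False by (metis div_less_iff_less_mult less_Suc_eq_le neq0_conv)
    qed
  qed simp
  ultimately show ?thesis unfolding computable2_def by simp
qed

lemma computable_div: "computable k a \<Longrightarrow> computable k b \<Longrightarrow> computable k (\<lambda>xs. a xs div b xs)"
  by (rule computable2_app[OF computable2_div])

lemma computable_mod:
  assumes "computable k a" "computable k b" shows "computable k (\<lambda>xs. a xs mod b xs)"
  unfolding minus_div_mult_eq_mod[symmetric]
  by (intro computable_diff computable_mult computable_div assms)

section \<open>Pairing and its inverse\<close>

lemma computable_prod_encode:
  "computable k a \<Longrightarrow> computable k b \<Longrightarrow> computable k (\<lambda>xs. prod_encode (a xs, b xs))"
  unfolding prod_encode_def triangle_def
  by (simp, intro computable_add computable_div computable_mult computable_Suc computable_const)

text \<open>Both components of a pair are at most its code, so decoding is a minimisation with a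
  bounded search inside.\<close>

lemma prod_decode_fst_Least: "fst (prod_decode z) = (LEAST u. \<exists>v<Suc z. prod_encode (u, v) = z)"
proof (rule Least_equality[symmetric])
  show "\<exists>v<Suc z. prod_encode (fst (prod_decode z), v) = z"
    by (rule exI[of _ "snd (prod_decode z)"])
       (metis le_imp_less_Suc le_prod_encode_2 prod.collapse prod_decode_inverse)
qed auto

lemma prod_decode_snd_Least: "snd (prod_decode z) = (LEAST v. \<exists>u<Suc z. prod_encode (u, v) = z)"
proof (rule Least_equality[symmetric])
  show "\<exists>u<Suc z. prod_encode (u, snd (prod_decode z)) = z"
    by (rule exI[of _ "fst (prod_decode z)"])
       (metis le_imp_less_Suc le_prod_encode_1 prod.collapse prod_decode_inverse)
qed auto

lemma computable_fst_decode: "computable k a \<Longrightarrow> computable k (\<lambda>xs. fst (prod_decode (a xs)))"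
proof (rule computable1_app[where F = "\<lambda>z. fst (prod_decode z)"])
  have d: "decidable (Suc 1) (\<lambda>ys. \<exists>v<Suc (drop 1 ys ! 0). prod_encode (ys ! 0, v) = drop 1 ys ! 0)"
    by (intro decidable_bex decidable_eq computable_prod_encode computable_Suc
        computable_drop computable_drop2 computable_nth) auto
  have "computable 1 (\<lambda>xs. LEAST u. \<exists>v<Suc (xs ! 0). prod_encode (u, v) = xs ! 0)"
    by (rule computable_Least_dec[OF d])
       (metis le_imp_less_Suc le_prod_encode_2 prod.collapse prod_decode_inverse)
  then show "computable1 (\<lambda>z. fst (prod_decode z))"
    unfolding computable1_def prod_decode_fst_Least .
qed

lemma computable_snd_decode: "computable k a \<Longrightarrow> computable k (\<lambda>xs. snd (prod_decode (a xs)))"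
proof (rule computable1_app[where F = "\<lambda>z. snd (prod_decode z)"])
  have d: "decidable (Suc 1) (\<lambda>ys. \<exists>u<Suc (drop 1 ys ! 0). prod_encode (u, ys ! 0) = drop 1 ys ! 0)"
    by (intro decidable_bex decidable_eq computable_prod_encode computable_Suc
        computable_drop computable_drop2 computable_nth) auto
  have "computable 1 (\<lambda>xs. LEAST v. \<exists>u<Suc (xs ! 0). prod_encode (u, v) = xs ! 0)"
    by (rule computable_Least_dec[OF d])
       (metis le_imp_less_Suc le_prod_encode_1 prod.collapse prod_decode_inverse)
  then show "computable1 (\<lambda>z. snd (prod_decode z))"
    unfolding computable1_def prod_decode_snd_Least .
qed

lemmas computable_intros = computable_nth computable_drop computable_drop2 computable_drop3
  computable_const computable_Suc computable_add computable_diff computable_mult computable_power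
  computable_div computable_mod computable_if computable_prod_encode computable_fst_decode
  computable_snd_decode decidable_not decidable_conj decidable_disj decidable_imp decidable_less
  decidable_le decidable_eq decidable_ball decidable_bex

text \<open>The points of disagreement are repaired one at a time, each by a single case
  distinction.\<close>

lemma computable1_finite_change:
  assumes "computable1 f" "finite {q. g q \<noteq> f q}"
  shows "computable1 g"
proof -
  have "\<lbrakk>finite D; {q. g q \<noteq> f q} = D; computable1 f\<rbrakk> \<Longrightarrow> computable1 g" for D f
  proof (induction D arbitrary: f rule: finite_induct)
    case empty
    then have "f = g" by auto
    then show ?case using empty by simp
  next
    case (insert a D)
    define f' where "f' q = (if q = a then g a else f q)" for q
    have "computable1 f'" unfolding computable1_def f'_def
      using insert.prems(2)[unfolded computable1_def]
      by (intro computable_if decidable_eq computable_nth computable_const) simp_all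
    moreover have "{q. g q \<noteq> f' q} = D"
    proof (rule set_eqI)
      fix q
      have "g q \<noteq> f q \<longleftrightarrow> q = a \<or> q \<in> D" using insert.prems(1) by blast
      then show "q \<in> {q. g q \<noteq> f' q} \<longleftrightarrow> q \<in> D"
        using insert.hyps(2) by (cases "q = a") (simp_all add: f'_def)
    qed
    ultimately show ?case using insert.IH by blast
  qed
  then show ?thesis using assms by blast
qed

text \<open>Used to merge the actions of finitely many letters into one function that takes the
  letter as an argument; nothing is promised for \<open>k \<ge> N\<close>.\<close>

lemma computable2_finite_cases:
  assumes "\<And>k. k < N \<Longrightarrow> computable1 (h k)"
  shows "\<exists>F. computable2 F \<and> (\<forall>k<N. \<forall>q. F k q = h k q)"
  using assms
proof (induction N)
  case 0
  have "computable2 (\<lambda>_ _. 0)" unfolding computable2_def by (rule computable_const)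
  then show ?case by blast
next
  case (Suc N)
  then obtain F where F: "computable2 F" "\<forall>k<N. \<forall>q. F k q = h k q" by auto
  let ?F = "\<lambda>k q. if k < N then F k q else h N q"
  have "computable 2 (\<lambda>xs. h N (xs ! 1))"
    by (rule computable1_app[where F = "h N"]) (auto intro: Suc.prems computable_nth)
  moreover have "computable 2 (\<lambda>xs. F (xs ! 0) (xs ! 1))" using F(1) unfolding computable2_def .
  moreover have "decidable 2 (\<lambda>xs. xs ! 0 < N)"
    by (intro decidable_less computable_nth computable_const) simp
  ultimately have "computable2 ?F" unfolding computable2_def by (intro computable_if)
  then show ?case using F(2) by (intro exI[of _ ?F]) (auto simp: less_Suc_eq)
qed

section \<open>Integer powers and quasi-periodic maps\<close>

definition zpow :: "('a \<Rightarrow> 'a) \<Rightarrow> int \<Rightarrow> 'a \<Rightarrow> 'a" where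
  "zpow f w = (if w \<ge> 0 then f ^^ nat w else inv f ^^ nat (- w))"

lemma zpow_of_nat [simp]: "zpow f (int k) = f ^^ k"
  by (simp add: zpow_def)

lemma zpow_0 [simp]: "zpow f 0 = id"
  by (simp add: zpow_def)

lemma zpow_1 [simp]: "zpow f 1 = f"
  by (simp add: zpow_def)

lemma zpow_Suc: "bij f \<Longrightarrow> zpow f (w + 1) q = f (zpow f w q)"
proof (cases "w \<ge> 0")
  case True
  then have "nat (w + 1) = Suc (nat w)" by simp
  then show ?thesis using True by (simp add: zpow_def)
next
  case False
  assume f: "bij f"
  define k where "k = nat (- w - 1)"
  have w: "w = - int (Suc k)" using False unfolding k_def by simp
  have "f (zpow f w q) = (inv f ^^ k) q"
    using f unfolding w zpow_def by (simp add: surj_f_inv_f bij_is_surj del: of_nat_Suc)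
  moreover have "zpow f (w + 1) q = (inv f ^^ k) q"
    unfolding w zpow_def by (cases k) (simp_all add: nat_add_distrib)
  ultimately show ?thesis by simp
qed

lemma zpow_add:
  assumes "bij f"
  shows "zpow f (v + w) q = zpow f v (zpow f w q)"
proof (induction v rule: int_induct[where k = 0])
  case base
  then show ?case by simp
next
  case (step1 i)
  then show ?case using zpow_Suc[OF assms, of "i + w" q] zpow_Suc[OF assms, of i "zpow f w q"]
    by (simp add: algebra_simps)
next
  case (step2 i)
  have "f (zpow f (i - 1 + w) q) = f (zpow f (i - 1) (zpow f w q))"
    using zpow_Suc[OF assms, of "i - 1 + w" q] zpow_Suc[OF assms, of "i - 1" "zpow f w q"] step2
    by (simp add: algebra_simps)
  then show ?case using assms by (simp add: bij_is_inj inj_eq)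
qed

lemma zpow_eq_iff: "bij f \<Longrightarrow> zpow f w q = r \<longleftrightarrow> q = zpow f (- w) r"
  using zpow_add[of f "- w" w q] zpow_add[of f w "- w" r] by auto

lemma zpow_inj: "bij f \<Longrightarrow> zpow f w q = zpow f w r \<longleftrightarrow> q = r"
  using zpow_eq_iff[of f w q "zpow f w r"] zpow_eq_iff[of f w r "zpow f w r"] by metis

lemma zpow_intertwine:
  assumes "bij f" "bij g" "\<And>q. x (f q) = g (x q)"
  shows "x (zpow f w q) = zpow g w (x q)"
proof (induction w rule: int_induct[where k = 0])
  case base
  then show ?case by simp
next
  case (step1 i)
  then show ?case by (simp add: zpow_Suc assms)
next
  case (step2 i)
  have "g (x (zpow f (i - 1) q)) = g (zpow g (i - 1) (x q))"
    using zpow_Suc[OF assms(1), of "i - 1" q] zpow_Suc[OF assms(2), of "i - 1" "x q"] step2 assms(3)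
    by simp
  then show ?case using assms(2) by (simp add: bij_is_inj inj_eq)
qed

lemma zpow_mult_fix:
  assumes "bij f" "zpow f w q = q"
  shows "zpow f (w * v) q = q"
proof (induction v rule: int_induct[where k = 0])
  case (step1 i)
  then show ?case using zpow_add[OF assms(1), of w "w * i" q] assms(2) by (simp add: algebra_simps)
next
  case (step2 i)
  have "zpow f w (zpow f (w * (i - 1)) q) = zpow f w q"
    using zpow_add[OF assms(1), of w "w * (i - 1)" q] assms(2) step2 by (simp add: algebra_simps)
  then show ?case using zpow_inj[OF assms(1)] by blast
qed simp

text \<open>Later \<open>u\<close> gives the exponent preferred by each ray, and rays joined by an
  orbit turn out to have exponents at most \<open>c\<close> apart. Linking all such indices gives a
  graph with at most \<open>card I ^ 2\<close> edges, so a chain inside a component changes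
  \<open>u\<close> by at most \<open>c\<close> times that number; \<open>e\<close> takes the value
  of \<open>u\<close> at one chosen index per component.\<close>

lemma cluster_shift:
  fixes u :: "'i \<Rightarrow> int"
  assumes "finite I" "c \<ge> 0"
  obtains e where "\<And>i. i \<in> I \<Longrightarrow> \<bar>u i - e i\<bar> \<le> c * int (card I)^2"
    and "\<And>i j. i \<in> I \<Longrightarrow> j \<in> I \<Longrightarrow> \<bar>u i - u j\<bar> \<le> c \<Longrightarrow> e i = e j"
proof -
  define R where "R = {(i, j). i \<in> I \<and> j \<in> I \<and> \<bar>u i - u j\<bar> \<le> c}"
  have RI: "R \<subseteq> I \<times> I" unfolding R_def by auto
  then have fR: "finite R" using assms(1) by (metis finite_SigmaI finite_subset)
  have cR: "card R \<le> card I ^ 2"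
    using card_mono[OF _ RI] assms(1) by (simp add: power2_eq_square)
  have steps: "(i, j) \<in> R ^^ k \<Longrightarrow> \<bar>u i - u j\<bar> \<le> c * int k" for i j k
  proof (induction k arbitrary: j)
    case (Suc k)
    then obtain m where m: "(i, m) \<in> R ^^ k" "(m, j) \<in> R" by auto
    have "\<bar>u m - u j\<bar> \<le> c" using m(2) unfolding R_def by auto
    then show ?case using Suc.IH[OF m(1)] by (simp add: algebra_simps)
  qed simp
  have star: "\<bar>u i - u j\<bar> \<le> c * int (card I)^2" if ij: "(i, j) \<in> R\<^sup>*" for i j
  proof -
    obtain k where k: "k \<le> card R" "(i, j) \<in> R ^^ k"
      using ij unfolding rtrancl_finite_eq_relpow[OF fR] by blast
    have "c * int k \<le> c * int (card I)^2"
      using k(1) cR assms(2) by (intro mult_left_mono) (auto simp flip: of_nat_power)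
    then show ?thesis using steps[OF k(2)] by simp
  qed
  have sym: "sym (R\<^sup>*)" by (rule sym_rtrancl) (auto simp: sym_def R_def abs_minus_commute)
  define e where "e i = u (SOME j. (i, j) \<in> R\<^sup>*)" for i
  show ?thesis
  proof
    fix i assume "i \<in> I"
    have "(i, SOME j. (i, j) \<in> R\<^sup>*) \<in> R\<^sup>*" by (rule someI[of _ i]) simp
    then show "\<bar>u i - e i\<bar> \<le> c * int (card I)^2" unfolding e_def by (rule star)
  next
    fix i j assume "i \<in> I" "j \<in> I" "\<bar>u i - u j\<bar> \<le> c"
    then have ij: "(i, j) \<in> R\<^sup>*" "(j, i) \<in> R\<^sup>*"
      unfolding R_def by (auto simp: abs_minus_commute)
    \<comment> \<open>Linked indices reach the same set of indices, so the choice operator returns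
      the same representative for both.\<close>
    then have "(i, k) \<in> R\<^sup>* \<longleftrightarrow> (j, k) \<in> R\<^sup>*" for k by (meson rtrancl_trans)
    then show "e i = e j" unfolding e_def by simp
  qed
qed

section \<open>Maps commuting with a shift far out\<close>

lemma shift_iterate:
  fixes f :: "nat \<Rightarrow> nat"
  assumes "\<And>q. q \<ge> Z \<Longrightarrow> f (q + n) = f q + n" "q \<ge> Z"
  shows "f (q + n * j) = f q + n * j"
proof (induction j)
  case (Suc j)
  then show ?case using assms(1)[of "q + n * j"] assms(2) by (simp add: algebra_simps)
qed simp

lemma shift_displacement:
  fixes f :: "nat \<Rightarrow> nat"
  assumes f: "\<And>q. q \<ge> Z \<Longrightarrow> f (q + n) = f q + n" and "q \<ge> Z" "r \<ge> Z" "q mod n = r mod n"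
  shows "int (f q) - int q = int (f r) - int r"
proof -
  have *: "int (f q) - int q = int (f r) - int r" if qr: "q \<le> r" "q \<ge> Z" "q mod n = r mod n" for q r
  proof -
    obtain j where j: "r = q + n * j" using qr(1,3)
      by (metis mod_eq_nat2E)
    then show ?thesis using shift_iterate[of Z f n q j] f qr(2) by auto
  qed
  show ?thesis
  proof (cases "q \<le> r")
    case True
    show ?thesis by (rule *[OF True assms(2,4)])
  next
    case False
    then show ?thesis using *[of r q, OF _ assms(3) assms(4)[symmetric]] by linarith
  qed
qed

text \<open>One constant serves as bound on the displacement and as threshold for periodicity. A map
  displaced by at most \<open>L\<close> sends points from \<open>K + L\<close> on to points from
  \<open>K\<close> on, so the constants simply add under composition.\<close>

definition quasi_periodic :: "nat \<Rightarrow> nat \<Rightarrow> (nat \<Rightarrow> nat) \<Rightarrow> bool" where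
  "quasi_periodic n K g \<longleftrightarrow> bij g \<and> (\<forall>q. g q \<le> q + K \<and> q \<le> g q + K) \<and> (\<forall>q\<ge>K. g (q + n) = g q + n)"

lemma quasi_periodic_mono: "quasi_periodic n K g \<Longrightarrow> K \<le> L \<Longrightarrow> quasi_periodic n L g"
  unfolding quasi_periodic_def by (meson add_left_mono le_trans)

lemma quasi_periodic_id: "quasi_periodic n K id"
  unfolding quasi_periodic_def by simp

lemma quasi_periodic_comp:
  assumes g: "quasi_periodic n K g" and h: "quasi_periodic n L h"
  shows "quasi_periodic n (K + L) (g \<circ> h)"
  unfolding quasi_periodic_def
proof (intro conjI allI impI)
  show "bij (g \<circ> h)" using assms unfolding quasi_periodic_def by (simp add: bij_comp)
  fix q
  have "g (h q) \<le> h q + K" "h q \<le> q + L" "h q \<le> g (h q) + K" "q \<le> h q + L"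
    using assms unfolding quasi_periodic_def by blast+
  then show "(g \<circ> h) q \<le> q + (K + L)" "q \<le> (g \<circ> h) q + (K + L)" by auto
  assume q: "q \<ge> K + L"
  then have "h q \<ge> K" using \<open>q \<le> h q + L\<close> by simp
  then show "(g \<circ> h) (q + n) = (g \<circ> h) q + n"
    using q assms unfolding quasi_periodic_def by simp
qed

text \<open>The factor 2 is for the threshold: a point not below \<open>2 * K\<close> has its
  preimage not below \<open>K\<close>.\<close>

lemma quasi_periodic_inv:
  assumes g: "quasi_periodic n K g"
  shows "quasi_periodic n (2 * K) (inv g)"
proof -
  have b: "bij g" and d: "\<And>q. g q \<le> q + K" "\<And>q. q \<le> g q + K"
    and s: "\<And>q. q \<ge> K \<Longrightarrow> g (q + n) = g q + n"
    using g unfolding quasi_periodic_def by auto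
  have gi: "g (inv g q) = q" for q using b by (simp add: bij_is_surj surj_f_inv_f)
  show ?thesis unfolding quasi_periodic_def
  proof (intro conjI allI impI)
    show "bij (inv g)" using b by (rule bij_imp_bij_inv)
    fix q
    show "inv g q \<le> q + 2 * K" "q \<le> inv g q + 2 * K" using d[of "inv g q"] gi[of q] by auto
    assume "q \<ge> 2 * K"
    then have "inv g q \<ge> K" using d(1)[of "inv g q"] gi[of q] by simp
    then have "g (inv g q + n) = q + n" using s gi by simp
    then show "inv g (q + n) = inv g q + n" using b by (metis bij_inv_eq_iff)
  qed
qed

lemma quasi_periodic_funpow: "quasi_periodic n K g \<Longrightarrow> quasi_periodic n (k * K) (g ^^ k)"
proof (induction k)
  case 0
  then show ?case using quasi_periodic_id by (simp add: id_def)
next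
  case (Suc k)
  then show ?case using quasi_periodic_comp[of n K g "k * K" "g ^^ k"] by (simp add: comp_def)
qed

text \<open>By the pigeonhole principle two of the first \<open>n + 1\<close> iterates of
  \<open>i\<close> agree. Injectivity cancels their common part, and the return time that remains is
  at most \<open>n\<close>, so it divides \<open>fact n\<close>.\<close>

lemma fact_period:
  assumes "inj_on s {..<n}" "s ` {..<n} \<subseteq> {..<n}" "i < n"
  shows "(s ^^ fact n) i = (i :: nat)"
proof -
  have st: "(s ^^ k) j < n" if "j < n" for j k
    using that assms(2) by (induction k) auto
  have "\<not> inj_on (\<lambda>k. (s ^^ k) i) {..n}"
  proof
    assume "inj_on (\<lambda>k. (s ^^ k) i) {..n}"
    then have "card {..n} \<le> card {..<n}"
      by (rule card_inj_on_le) (use st assms(3) in auto)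
    then show False by simp
  qed
  then obtain a b where ab: "a < b" "b \<le> n" "(s ^^ a) i = (s ^^ b) i"
    unfolding inj_on_def by (metis atMost_iff linorder_neqE_nat)
  have inj: "(s ^^ k) u = (s ^^ k) v \<Longrightarrow> u < n \<Longrightarrow> v < n \<Longrightarrow> u = v" for k u v
  proof (induction k)
    case (Suc k)
    then show ?case using assms(1) st by (auto simp: inj_on_def)
  qed simp
  have "(s ^^ a) ((s ^^ (b - a)) i) = (s ^^ a) i"
    using ab by (metis add_diff_inverse_nat comp_apply funpow_add nat_less_le not_less)
  then have fx: "(s ^^ (b - a)) i = i" using inj st assms(3) by blast
  have "b - a dvd fact n" using ab by (intro dvd_fact) auto
  then obtain m where m: "fact n = (b - a) * m" ..
  have "((s ^^ (b - a)) ^^ m) i = i" using fx by (induction m) auto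
  then show ?thesis unfolding m by (simp add: funpow_mult)
qed

section \<open>Far dynamics of one quasi-periodic map: drifts and transit times\<close>

locale quasi_periodic_map =
  fixes n d K :: nat and A :: "nat \<Rightarrow> nat"
  assumes n_pos: "n > 0" and d_def: "d = fact n" and qp: "quasi_periodic n K A"
begin

text \<open>Each step lowers a point by at most \<open>K\<close>, so from \<open>M\<close> on the
  first \<open>d\<close> iterates stay in the range where \<open>A\<close> commutes with the shift
  by \<open>n\<close>.\<close>

definition M :: nat where "M = d * K + K"

lemma nM: "M \<le> i + n * M"
  using n_pos by (simp add: trans_le_add2)

lemma d_pos: "d > 0" using d_def by simp

lemma bij: "bij A" using qp unfolding quasi_periodic_def by blast

lemma pow_le: "(A ^^ k) q \<le> q + k * K" "q \<le> (A ^^ k) q + k * K"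
  using quasi_periodic_funpow[OF qp, of k] unfolding quasi_periodic_def by auto

lemma pow_shift:
  assumes "k * K \<le> q" shows "(A ^^ k) (q + n) = (A ^^ k) q + n"
  using quasi_periodic_funpow[OF qp, of k] assms unfolding quasi_periodic_def by auto

lemma pow_shift_mult:
  assumes "k * K \<le> q" shows "(A ^^ k) (q + n * j) = (A ^^ k) q + n * j"
  by (rule shift_iterate[of "k * K"]) (use pow_shift assms in auto)

lemma pow_displacement:
  assumes "k * K \<le> q" "k * K \<le> r" "q mod n = r mod n"
  shows "int ((A ^^ k) q) - int q = int ((A ^^ k) r) - int r"
  by (rule shift_displacement[of "k * K"]) (use pow_shift assms in auto)

lemma mod_eq_of_displacement:
  assumes "int a - int q = int b - int r" "q mod n = r mod n"
  shows "a mod n = b mod n"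
proof -
  have "int n dvd int q - int r"
    using assms(2) by (metis mod_eq_dvd_iff of_nat_mod)
  moreover have "int q - int r = int a - int b" using assms(1) by simp
  ultimately have "int n dvd int a - int b" by simp
  then show ?thesis by (metis mod_eq_dvd_iff of_nat_eq_iff of_nat_mod)
qed

lemma pow_mod:
  assumes "k * K \<le> q" "k * K \<le> r" "q mod n = r mod n"
  shows "(A ^^ k) q mod n = (A ^^ k) r mod n"
  using mod_eq_of_displacement[OF pow_displacement[OF assms] assms(3)] .

lemma le_M: "k \<le> d \<Longrightarrow> M \<le> q \<Longrightarrow> k * K \<le> q"
  using mult_le_mono1[of k d K] unfolding M_def by linarith

lemma pow_d_mod:
  assumes "q \<ge> M" shows "(A ^^ d) q mod n = q mod n"
proof -
  \<comment> \<open>The map that \<open>A\<close> induces on residues far out, sampled at points not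
    below \<open>K\<close>.\<close>
  define s where "s i = A (i + n * K) mod n" for i
  have nK: "n * K \<ge> K" using n_pos by simp
  have A_mod: "A r mod n = s (r mod n)" if "r \<ge> K" for r
    using pow_mod[of 1 r "r mod n + n * K"] that nK unfolding s_def by simp
  have "inj_on s {..<n}"
  proof (rule inj_onI)
    fix i j assume ij: "i \<in> {..<n}" "j \<in> {..<n}" "s i = s j"
    \<comment> \<open>If the images are congruent, a multiple of \<open>n\<close> raises the lower
      one to the other. This shift passes through \<open>A\<close>, and injectivity of
      \<open>A\<close> then compares the arguments.\<close>
    have "i = j" if le: "A (i + n * K) \<le> A (j + n * K)" and l: "i < n" "j < n" and e: "s i = s j" for i j
    proof -
      obtain u where u: "A (j + n * K) = A (i + n * K) + n * u"
        using e le unfolding s_def by (metis mod_eq_nat2E)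
      also have "\<dots> = A (i + n * K + n * u)" using pow_shift_mult[of 1 "i + n * K" u] nK by simp
      finally have "j + n * K = i + n * K + n * u" using bij by (simp add: bij_is_inj inj_eq)
      then have "j = i + n * u" by simp
      then show ?thesis using l by (metis mod_less mod_mult_self2)
    qed
    then show "i = j" using ij by (metis lessThan_iff nat_le_linear)
  qed
  moreover have "s ` {..<n} \<subseteq> {..<n}" using n_pos unfolding s_def by auto
  ultimately have fx: "(s ^^ d) (q mod n) = q mod n"
    using fact_period[of s n "q mod n"] n_pos unfolding d_def by simp
  have "k \<le> d \<Longrightarrow> (A ^^ k) q mod n = (s ^^ k) (q mod n)" for k
  proof (induction k)
    case (Suc k)
    have "(A ^^ k) q + k * K \<ge> M" using pow_le(2)[of q k] assms by simp
    moreover have "(k + 1) * K \<le> d * K" using Suc.prems by (intro mult_le_mono1) simp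
    ultimately have "(A ^^ k) q \<ge> K" unfolding M_def by (simp add: algebra_simps)
    then show ?case using A_mod Suc by simp
  qed simp
  then show ?thesis using fx by simp
qed

text \<open>The sample point is not below \<open>M\<close>; \<open>pow_d_drift\<close> shows that
  any other such point of the residue class would give the same value.\<close>

definition drift :: "nat \<Rightarrow> int" where
  "drift i = int ((A ^^ d) (i + n * M)) - int (i + n * M)"

lemma pow_d_drift:
  assumes "q \<ge> M" shows "int ((A ^^ d) q) = int q + drift (q mod n)"
proof -
  have "d * K \<le> q mod n + n * M" using nM[of "q mod n"] unfolding M_def by linarith
  moreover have "d * K \<le> q" using assms unfolding M_def by linarith
  ultimately show ?thesis
    using pow_displacement[of d q "q mod n + n * M"] assms unfolding drift_def by simp
qed

lemma drift_bound: "\<bar>drift i\<bar> \<le> int (d * K)"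
  using pow_le[where k = d and q = "i + n * M"] unfolding drift_def by linarith

lemma drift_dvd: "int n dvd drift i"
proof -
  have "(A ^^ d) (i + n * M) mod n = (i + n * M) mod n" by (rule pow_d_mod[OF nM])
  then show ?thesis unfolding drift_def by (metis mod_eq_dvd_iff of_nat_mod)
qed

lemma mod_eq_dvd: "int r = int q + c \<Longrightarrow> int n dvd c \<Longrightarrow> r mod n = q mod n"
  by (metis add_diff_cancel_left' mod_eq_dvd_iff of_nat_eq_iff of_nat_mod)

lemma zpow_drift:
  assumes "q \<ge> M" "r \<ge> M" "int r = int q + w * drift (q mod n)"
  shows "zpow A (int d * w) q = r"
proof -
  have nat: "zpow A (int d * int k) q = r"
    if "q \<ge> M" "r \<ge> M" "int r = int q + int k * drift (q mod n)" for q r k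
    using that
  proof (induction k arbitrary: r)
    case (Suc k)
    let ?D = "drift (q mod n)"
    \<comment> \<open>The intermediate point is bounded below by \<open>q\<close> or by
      \<open>r\<close>, according to the sign of the drift, so it does not leave the range where
      \<open>pow_d_drift\<close> applies.\<close>
    have "int q + int k * ?D \<ge> int M"
    proof (cases "?D \<ge> 0")
      case True
      then have "int k * ?D \<ge> 0" by simp
      then show ?thesis using Suc.prems(1) by linarith
    next
      case False
      then show ?thesis using Suc.prems(2,3) by (simp add: algebra_simps)
    qed
    then obtain m where m: "m \<ge> M" "int m = int q + int k * ?D"
      by (metis nat_0_le nat_int of_nat_0_le_iff order_trans zle_int)
    then have "zpow A (int d * int k) q = m" using Suc by blast
    moreover have "m mod n = q mod n" using m(2) drift_dvd mod_eq_dvd by (metis dvd_mult)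
    then have "(A ^^ d) m = r" using pow_d_drift[OF m(1)] m(2) Suc.prems(3) by (simp add: algebra_simps)
    ultimately show ?case using zpow_add[OF bij, of "int d" "int d * int k" q]
      by (simp add: algebra_simps)
  qed simp
  show ?thesis
  proof (cases "w \<ge> 0")
    case True
    then show ?thesis using nat[of q r "nat w"] assms by simp
  next
    case False
    have "r mod n = q mod n" using assms(3) drift_dvd mod_eq_dvd by (metis dvd_mult)
    then have "zpow A (int d * int (nat (- w))) r = q" using nat[of r q "nat (- w)"] assms False by simp
    then show ?thesis using False zpow_eq_iff[OF bij, of "int d * w" q r] by simp
  qed
qed

lemma moving_not_fixed:
  assumes "q \<ge> M" "drift (q mod n) \<noteq> 0" "zpow A k q = q" shows "k = 0"
proof (rule ccontr)
  assume k: "k \<noteq> 0"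
  let ?D = "drift (q mod n)"
  \<comment> \<open>The sign is chosen so that the power of \<open>A\<close> with exponent
    \<open>d * w\<close> moves \<open>q\<close> outward; but that exponent is a multiple of
    \<open>k\<close>, so it would have to fix \<open>q\<close>.\<close>
  define w where "w = k * (sgn ?D * sgn k)"
  have "w * ?D = \<bar>k\<bar> * \<bar>?D\<bar>" unfolding w_def by (simp add: abs_sgn ac_simps)
  moreover have "\<bar>k\<bar> * \<bar>?D\<bar> > 0" using k assms(2) by simp
  ultimately have pos: "w * ?D > 0" by simp
  define r where "r = nat (int q + w * ?D)"
  have r: "int r = int q + w * ?D" using pos unfolding r_def by simp
  then have "r \<ge> M" "r \<noteq> q" using pos assms(1) by linarith+
  then have "zpow A (int d * w) q \<noteq> q" using zpow_drift[OF assms(1) _ r] by simp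
  moreover have "int d * w = k * (int d * (sgn ?D * sgn k))" unfolding w_def by simp
  ultimately show False using zpow_mult_fix[OF bij assms(3)] by metis
qed

text \<open>An orbit that starts and ends near the centre cannot visit a far point in between: with
  nonnegative drift there it could not come down to \<open>r\<close> again, and with negative drift
  it could not have come up from \<open>p\<close>. The visited points are distinct because
  \<open>p\<close> is on a moving ray, so their number is bounded by the height
  \<open>?H\<close>.\<close>

lemma transit_nat:
  assumes p: "p \<ge> M" "p \<le> M + 3 * (d * K)" "drift (p mod n) \<noteq> 0"
    and r: "r \<le> M + 3 * (d * K)" "(A ^^ k) p = r"
  shows "k \<le> M + 5 * (d * K)"
proof -
  let ?H = "M + 4 * (d * K)"
  have moving: "(A ^^ i) p \<noteq> (A ^^ j) p" if "i < j" for i j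
  proof
    assume "(A ^^ i) p = (A ^^ j) p"
    then have "zpow A (int j - int i) p = p"
      using zpow_add[OF bij, of "int i" "int j - int i" p] zpow_inj[OF bij, of "int i"] by simp
    then have "int j - int i = 0" by (rule moving_not_fixed[OF p(1,3)])
    then show False using that by simp
  qed
  have low: "(A ^^ h) p \<le> ?H" if h: "h \<le> k" for h
  proof (rule ccontr)
    define g where "g = (A ^^ h) p"
    let ?D = "drift (g mod n)"
    assume "\<not> (A ^^ h) p \<le> ?H"
    then have g: "g > ?H" unfolding g_def by simp
    have gM: "g \<ge> M" using g by simp
    have c_le: "c < d \<Longrightarrow> c * K \<le> d * K" for c by simp
    show False
    proof (cases "?D \<ge> 0")
      case True
      \<comment> \<open>Full blocks of \<open>d\<close> steps do not lower \<open>g\<close>, and the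
        fewer than \<open>d\<close> steps left over lower it by at most \<open>d * K\<close>, which
        keeps it above \<open>M + 3 * (d * K)\<close>.\<close>
      define a c where "a = (k - h) div d" and "c = (k - h) mod d"
      have kh: "k = c + (d * a + h)" using h unfolding a_def c_def by simp
      define g' where "g' = g + nat (int a * ?D)"
      have "zpow A (int d * int a) g = g'"
        by (rule zpow_drift[OF gM]) (use True gM in \<open>auto simp: g'_def\<close>)
      then have "(A ^^ (d * a)) g = g'" by (metis of_nat_mult zpow_of_nat)
      then have "r = (A ^^ c) g'" using r(2) unfolding kh funpow_add g_def by simp
      then have "g \<le> r + c * K" using pow_le(2)[of g' c] unfolding g'_def by simp
      moreover have "c * K \<le> d * K" using c_le d_pos unfolding c_def by simp
      ultimately show False using g r(1) by linarith
    next
      case False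
      define a c where "a = h div d" and "c = h mod d"
      have hh: "h = d * a + c" unfolding a_def c_def by simp
      define g' where "g' = g + nat (- (int a * ?D))"
      have nn: "- (int a * ?D) \<ge> 0" using False by (simp add: mult_nonneg_nonpos)
      have "zpow A (int d * (- int a)) g = g'"
        by (rule zpow_drift[OF gM]) (use nn gM in \<open>auto simp: g'_def\<close>)
      then have "g = zpow A (int d * int a) g'"
        using zpow_eq_iff[OF bij, of "int d * (- int a)" g g'] by simp
      then have "(A ^^ (d * a)) g' = (A ^^ (d * a)) ((A ^^ c) p)"
        unfolding g_def hh funpow_add by (metis comp_apply of_nat_mult zpow_of_nat)
      then have "g' = (A ^^ c) p" using zpow_inj[OF bij, of "int (d * a)"] unfolding zpow_of_nat by blast
      then have "g \<le> p + c * K" using pow_le(1)[where q = p and k = c] unfolding g'_def by simp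
      moreover have "c * K \<le> d * K" using c_le d_pos unfolding c_def by simp
      ultimately show False using g p(2) by linarith
    qed
  qed
  have "inj_on (\<lambda>h. (A ^^ h) p) {..k}"
    using moving by (intro inj_onI) (metis linorder_neqE_nat)
  then have "card {..k} \<le> card {..?H}" by (rule card_inj_on_le) (use low in auto)
  then show ?thesis by simp
qed

lemma transit:
  assumes p: "p \<ge> M" "p \<le> M + 3 * (d * K)" "drift (p mod n) \<noteq> 0"
    and r: "r \<ge> M" "r \<le> M + 3 * (d * K)" "drift (r mod n) \<noteq> 0" and k: "zpow A k p = r"
  shows "\<bar>k\<bar> \<le> int (M + 5 * (d * K))"
proof (cases "k \<ge> 0")
  case True
  then have "nat k \<le> M + 5 * (d * K)" using transit_nat[OF p r(2), of "nat k"] k by (simp add: zpow_def)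
  then show ?thesis using True unfolding nat_le_iff by simp
next
  case False
  then have "zpow A (int (nat (- k))) r = p" using zpow_eq_iff[OF bij, of k p r] k by simp
  then have "(A ^^ nat (- k)) r = p" unfolding zpow_of_nat .
  then have "nat (- k) \<le> M + 5 * (d * K)" using transit_nat[OF r p(2), of "nat (- k)"] by blast
  then show ?thesis using False unfolding nat_le_iff by simp
qed

end

section \<open>Shortening the shifts on moving rays\<close>

text \<open>\<open>x\<close> is any conjugator, and \<open>K\<close> says nothing about its
  threshold \<open>Z\<close>. The aim is another conjugator with bounds in which \<open>Z\<close> no
  longer occurs.\<close>

locale conjugate_pair = a: quasi_periodic_map n d K A + b: quasi_periodic_map n d K B
  for n d K :: nat and A B :: "nat \<Rightarrow> nat" +
  fixes x :: "nat \<Rightarrow> nat" and Z :: nat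
  assumes x_bij: "bij x" and x_A: "x (A q) = B (x q)"
    and x_shift: "q \<ge> Z \<Longrightarrow> x (q + n) = x q + n"
    and x_mod: "q \<ge> Z \<Longrightarrow> x q mod n = q mod n"
begin

abbreviation M where "M \<equiv> a.M"

definition s :: "nat \<Rightarrow> int" where "s i = int (x (i + n * Z)) - int (i + n * Z)"

lemma x_s:
  assumes "q \<ge> Z" shows "int (x q) = int q + s (q mod n)"
proof -
  have "q mod n + n * Z \<ge> Z" using a.n_pos by (simp add: trans_le_add2)
  then show ?thesis using shift_displacement[of Z x n q "q mod n + n * Z"] x_shift assms
    unfolding s_def by simp
qed

lemma s_dvd: "int n dvd s i"
proof -
  have "i + n * Z \<ge> Z" using a.n_pos by (simp add: trans_le_add2)
  then have "x (i + n * Z) mod n = (i + n * Z) mod n" by (rule x_mod)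
  then show ?thesis unfolding s_def by (metis mod_eq_dvd_iff of_nat_mod)
qed

lemma x_zpow: "x (zpow A w q) = zpow B w (x q)"
  by (rule zpow_intertwine[where x = x, OF a.bij b.bij x_A])

lemma x_pow: "x ((A ^^ k) q) = (B ^^ k) (x q)"
  using x_zpow[of "int k" q] by simp

lemma far_point:
  fixes i L :: nat
  assumes "i < n" obtains q where "q \<ge> L" "q mod n = i"
proof
  show "i + n * L \<ge> L" using a.n_pos by (simp add: trans_le_add2)
  show "(i + n * L) mod n = i" using assms by simp
qed

lemma drift_eq:
  assumes "i < n" shows "a.drift i = b.drift i"
proof -
  \<comment> \<open>Far enough for \<open>q\<close>, its image under \<open>A ^^ d\<close> and
    \<open>x q\<close> all to lie where the translations hold; comparing both sides of
    \<open>x_pow\<close> there cancels the shift of \<open>x\<close>.\<close>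
  obtain q where q: "q \<ge> Z + M + d * K + nat \<bar>s i\<bar>" "q mod n = i"
    using far_point[OF assms] by blast
  have qM: "q \<ge> M" "q \<ge> Z" using q(1) by auto
  have 1: "(A ^^ d) q \<ge> Z" using a.pow_le(2)[of q d] q(1) by simp
  have xq: "int (x q) = int q + s i" using x_s[OF qM(2)] q(2) by simp
  have xM: "x q \<ge> M" using xq q(1) by linarith
  have "int (x ((A ^^ d) q)) = int q + a.drift i + s i"
    using x_s[OF 1] a.pow_d_mod[OF qM(1)] a.pow_d_drift[OF qM(1)] q(2) by simp
  moreover have "int ((B ^^ d) (x q)) = int q + s i + b.drift i"
    using b.pow_d_drift[OF xM] x_mod[OF qM(2)] q(2) xq by simp
  ultimately show ?thesis using x_pow[of d q] by simp
qed

lemma drift_mod_eq: "a.drift (q mod n) = b.drift (q mod n)"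
  by (rule drift_eq) (simp add: a.n_pos)

text \<open>A power of \<open>A\<close> carries \<open>q\<close> along its moving ray beyond
  \<open>Z\<close>, where \<open>x\<close> is a translation, and a power of \<open>B\<close> brings
  the image back. Hence the shift of \<open>x\<close> far out determines \<open>x\<close> on moving
  residues already from \<open>M\<close> on.\<close>

lemma forced:
  assumes q: "q \<ge> M" "a.drift (q mod n) \<noteq> 0"
    and r: "r \<ge> M" "int r = int q + s (q mod n) + w * a.drift (q mod n)"
  shows "zpow B (int d * w) (x q) = r"
proof -
  let ?D = "a.drift (q mod n)" and ?s = "s (q mod n)"
  define R where "R = int Z + int M + \<bar>?s\<bar> + 1"
  \<comment> \<open>The sign of \<open>W\<close> pushes \<open>q\<close> outward, and
    \<open>R\<close> is large enough for \<open>q1\<close> to pass \<open>Z\<close> and for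
    \<open>x q1\<close> to stay above \<open>M\<close>.\<close>
  define W where "W = sgn ?D * R"
  have "R \<ge> 0" unfolding R_def by simp
  then have WD: "W * ?D = R * \<bar>?D\<bar>" unfolding W_def by (simp add: abs_sgn ac_simps)
  have "R * 1 \<le> R * \<bar>?D\<bar>" using q(2) \<open>R \<ge> 0\<close> by (intro mult_left_mono) auto
  then have ge: "W * ?D \<ge> R" using WD by simp
  define q1 where "q1 = nat (int q + W * ?D)"
  have q1: "int q1 = int q + W * ?D" using ge \<open>R \<ge> 0\<close> unfolding q1_def by simp
  then have q1M: "q1 \<ge> M" "q1 \<ge> Z" using ge unfolding R_def by linarith+
  have q1mod: "q1 mod n = q mod n"
    using a.mod_eq_dvd[OF q1] a.drift_dvd by simp
  have A1: "zpow A (int d * W) q = q1" by (rule a.zpow_drift[OF q(1) q1M(1) q1])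
  have xq1: "int (x q1) = int q + W * ?D + ?s" using x_s[OF q1M(2)] q1 q1mod by simp
  then have xq1M: "x q1 \<ge> M" using ge unfolding R_def by linarith
  have "r mod n = q mod n"
    using a.mod_eq_dvd[of r q "?s + w * ?D"] r(2) a.drift_dvd s_dvd by (simp add: dvd_add)
  then have "zpow B (int d * (W - w)) r = x q1"
    using b.zpow_drift[OF r(1) xq1M, of "W - w"] r(2) xq1 drift_mod_eq
    by (simp add: algebra_simps)
  also have "x q1 = zpow B (int d * W) (x q)" using x_zpow A1 by metis
  also have "\<dots> = zpow B (int d * (W - w)) (zpow B (int d * w) (x q))"
    using zpow_add[OF b.bij, of "int d * (W - w)" "int d * w" "x q"] by (simp add: algebra_simps)
  finally show ?thesis using zpow_inj[OF b.bij] by metis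
qed

text \<open>The exponent of \<open>B ^^ d\<close> that reduces the shift of \<open>x\<close> to its
  remainder modulo the drift. On a static residue division by zero makes it 0.\<close>

definition wind :: "nat \<Rightarrow> int" where "wind i = - (s i div a.drift i)"

abbreviation "Y \<equiv> M + 5 * (d * K)"

lemma wind_le:
  assumes "a.drift i \<noteq> 0"
  shows "\<bar>s i + wind i * a.drift i\<bar> \<le> int (d * K)"
proof -
  have "s i + wind i * a.drift i = s i mod a.drift i"
    unfolding wind_def by (simp add: minus_div_mult_eq_mod[symmetric])
  moreover have "\<bar>s i mod a.drift i\<bar> < \<bar>a.drift i\<bar>" using assms by (rule abs_mod_less)
  ultimately show ?thesis using a.drift_bound[of i] by linarith
qed

text \<open>Unwound by their own exponents, the images of \<open>p\<close> and \<open>r\<close> lie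
  near the centre again, and a power of \<open>B\<close> joins them whose exponent is
  \<open>d\<close> times the difference of the two winds, plus \<open>k\<close>. Transit times of
  \<open>A\<close> and of \<open>B\<close> are both at most \<open>Y\<close>, which leaves at most
  \<open>2 * Y\<close> for the difference.\<close>

lemma wind_link:
  assumes p: "M + d * K \<le> p" "p \<le> M + 2 * (d * K)" "a.drift (p mod n) \<noteq> 0"
    and r: "M + d * K \<le> r" "r \<le> M + 2 * (d * K)" "a.drift (r mod n) \<noteq> 0"
    and k: "zpow A k p = r"
  shows "\<bar>wind (p mod n) - wind (r mod n)\<bar> \<le> int (2 * Y)"
proof -
  let ?t = "\<lambda>p. int p + s (p mod n) + wind (p mod n) * a.drift (p mod n)"
  have norm: "\<exists>p'. p' \<ge> M \<and> p' \<le> M + 3 * (d * K) \<and> p' mod n = p mod n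
      \<and> zpow B (int d * wind (p mod n)) (x p) = p'"
    if p: "M + d * K \<le> p" "p \<le> M + 2 * (d * K)" "a.drift (p mod n) \<noteq> 0" for p
  proof -
    define p' where "p' = nat (?t p)"
    have "\<bar>?t p - int p\<bar> \<le> int (d * K)" using wind_le[OF p(3)] by simp
    then have b: "?t p \<ge> int M" "?t p \<le> int (M + 3 * (d * K))" using p(1,2) by linarith+
    then have p': "int p' = ?t p" unfolding p'_def by simp
    then have "p' \<ge> M" "p' \<le> M + 3 * (d * K)" using b by linarith+
    moreover have "zpow B (int d * wind (p mod n)) (x p) = p'"
      by (rule forced[OF _ p(3) \<open>p' \<ge> M\<close> p']) (use p(1) in simp)
    moreover have "p' mod n = p mod n"
      using a.mod_eq_dvd[of p' p "s (p mod n) + wind (p mod n) * a.drift (p mod n)"] p'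
        a.drift_dvd s_dvd by (simp add: dvd_add)
    ultimately show ?thesis by blast
  qed
  obtain p' where p': "p' \<ge> M" "p' \<le> M + 3 * (d * K)" "p' mod n = p mod n"
      "zpow B (int d * wind (p mod n)) (x p) = p'" using norm[OF p] by blast
  obtain r' where r': "r' \<ge> M" "r' \<le> M + 3 * (d * K)" "r' mod n = r mod n"
      "zpow B (int d * wind (r mod n)) (x r) = r'" using norm[OF r] by blast
  let ?v = "int d * (wind (r mod n) - wind (p mod n)) + k"
  have "x r = zpow B k (x p)" using x_zpow k by metis
  then have "r' = zpow B (int d * wind (r mod n) + k) (x p)"
    using r'(4) zpow_add[OF b.bij] by metis
  also have "int d * wind (r mod n) + k = ?v + int d * wind (p mod n)" by (simp add: algebra_simps)
  also have "zpow B \<dots> (x p) = zpow B ?v p'" using p'(4) zpow_add[OF b.bij] by metis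
  finally have "\<bar>?v\<bar> \<le> int Y"
    using b.transit[OF p'(1,2) _ r'(1,2), of ?v] p(3) r(3) p'(3) r'(3) drift_mod_eq by metis
  moreover have "\<bar>k\<bar> \<le> int Y"
    by (rule a.transit[of p r]) (use p r k in auto)
  moreover have "\<bar>u\<bar> \<le> 2 * v" if "\<bar>u + k\<bar> \<le> v" "\<bar>k\<bar> \<le> v" for u v :: int
    using that by linarith
  ultimately have "\<bar>int d * (wind (r mod n) - wind (p mod n))\<bar> \<le> 2 * int Y" by blast
  moreover have "1 * \<bar>wind (r mod n) - wind (p mod n)\<bar> \<le> int d * \<bar>wind (r mod n) - wind (p mod n)\<bar>"
    using a.d_pos by (intro mult_right_mono) auto
  ultimately show ?thesis by (simp add: abs_mult abs_minus_commute)
qed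

text \<open>The first summand bounds the remainder left by \<open>wind\<close>. The second is the
  price of replacing \<open>wind\<close> by its cluster value: \<open>2 * Y * n^2\<close> extra
  turns, each worth at most \<open>d * K\<close>.\<close>

definition S :: nat where "S = d * K + 2 * Y * n^2 * (d * K)"

lemma unwind:
  obtains x1 where "bij x1" "\<And>q. x1 (A q) = B (x1 q)"
    "\<And>q. q \<ge> M + S \<Longrightarrow> a.drift (q mod n) \<noteq> 0 \<Longrightarrow>
       x1 (q + n) = x1 q + n \<and> x1 q mod n = q mod n \<and> \<bar>int (x1 q) - int q\<bar> \<le> int S"
proof -
  obtain e where e: "\<And>i. i \<in> {..<n} \<Longrightarrow> \<bar>wind i - e i\<bar> \<le> int (2 * Y) * int (card {..<n})^2"
    and e_eq: "\<And>i j. i \<in> {..<n} \<Longrightarrow> j \<in> {..<n} \<Longrightarrow> \<bar>wind i - wind j\<bar> \<le> int (2 * Y) \<Longrightarrow> e i = e j"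
    by (rule cluster_shift[of "{..<n}" "int (2 * Y)" wind, OF finite_lessThan of_nat_0_le_iff]) blast
  \<comment> \<open>The strip is at least as wide as every drift, so an orbit that is far out on a
    moving ray meets it when followed inward in steps of one drift.\<close>
  define P where "P = {p. M + d * K \<le> p \<and> p \<le> M + 2 * (d * K) \<and> a.drift (p mod n) \<noteq> 0}"
  define orb where "orb q = range (\<lambda>w. zpow A w q)" for q
  \<comment> \<open>An orbit through the strip gets the cluster exponent of a residue at which it
    crosses; by \<open>wind_link\<close> and the choice of \<open>e\<close> every crossing gives the
    same value. Orbits that miss the strip are left alone.\<close>
  define E where "E q = (if P \<inter> orb q = {} then 0 else e ((SOME p. p \<in> P \<inter> orb q) mod n))" for q
  have orb_zpow: "orb (zpow A w q) = orb q" for w q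
  proof -
    have "zpow A v (zpow A w q) \<in> orb q" for v
      unfolding orb_def zpow_add[OF a.bij, symmetric] by (rule rangeI)
    moreover have "zpow A v q \<in> orb (zpow A w q)" for v
      unfolding orb_def using zpow_add[OF a.bij, of "v - w" w q] by (intro image_eqI[of _ _ "v - w"]) simp_all
    ultimately show ?thesis unfolding orb_def by blast
  qed
  have E_zpow: "E (zpow A w q) = E q" for w q unfolding E_def orb_zpow ..
  have E_P: "E q = e (p mod n)" if p: "p \<in> P" "zpow A k q = p" for p q k
  proof -
    have "p \<in> P \<inter> orb q" using p unfolding orb_def by auto
    define p0 where "p0 = (SOME p. p \<in> P \<inter> orb q)"
    have p0: "p0 \<in> P \<inter> orb q" unfolding p0_def by (rule someI) (rule \<open>p \<in> P \<inter> orb q\<close>)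
    then obtain k0 where "p0 = zpow A k0 q" unfolding orb_def by auto
    then have "zpow A (k - k0) p0 = p"
      using zpow_add[OF a.bij, of "k - k0" k0 q] p(2) by simp
    then have "\<bar>wind (p0 mod n) - wind (p mod n)\<bar> \<le> int (2 * Y)"
      using p0 p(1) unfolding P_def by (intro wind_link) auto
    then have "e (p0 mod n) = e (p mod n)" using a.n_pos by (intro e_eq) auto
    moreover have "E q = e (p0 mod n)" unfolding E_def p0_def using \<open>p \<in> P \<inter> orb q\<close> by auto
    ultimately show ?thesis by simp
  qed
  define x1 where "x1 q = zpow B (int d * E q) (x q)" for q
  \<comment> \<open>In this form bijectivity reduces to that of \<open>x\<close>, since the power of
    \<open>A\<close> acts on each orbit with one fixed exponent.\<close>
  have x1': "x1 q = x (zpow A (int d * E q) q)" for q unfolding x1_def x_zpow ..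
  have "bij x1"
  proof (rule bijI)
    show "inj x1"
    proof (rule injI)
      fix q r assume "x1 q = x1 r"
      then have eq: "zpow A (int d * E q) q = zpow A (int d * E r) r"
        unfolding x1' using x_bij by (simp add: bij_is_inj inj_eq)
      then have "E q = E r" using E_zpow by metis
      then show "q = r" using eq zpow_inj[OF a.bij] by metis
    qed
    show "surj x1" unfolding surj_def
    proof
      fix r
      obtain q where q: "x q = r" using x_bij by (metis bij_pointE)
      define q' where "q' = zpow A (- (int d * E q)) q"
      have "E q' = E q" unfolding q'_def by (rule E_zpow)
      then have "zpow A (int d * E q') q' = q"
        using zpow_add[OF a.bij, of "int d * E q" "- (int d * E q)" q] unfolding q'_def by simp
      then show "\<exists>q. r = x1 q" using q unfolding x1' by metis
    qed
  qed
  moreover have "x1 (A q) = B (x1 q)" for q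
  proof -
    have "E (A q) = E q" using E_zpow[of 1 q] by simp
    then show ?thesis unfolding x1_def x_A
      using zpow_add[OF b.bij, of "int d * E q" 1 "x q"] zpow_add[OF b.bij, of 1 "int d * E q" "x q"]
      by (simp add: add.commute)
  qed
  moreover have "x1 (q + n) = x1 q + n \<and> x1 q mod n = q mod n \<and> \<bar>int (x1 q) - int q\<bar> \<le> int S"
    if q: "q \<ge> M + S" "a.drift (q mod n) \<noteq> 0" for q
  proof -
    define i where "i = q mod n"
    let ?c = "s i + e i * a.drift i"
    have "i \<in> {..<n}" using a.n_pos unfolding i_def by simp
    have c: "\<bar>?c\<bar> \<le> int S"
    proof -
      have "?c = s i + wind i * a.drift i + (e i - wind i) * a.drift i" by (simp add: algebra_simps)
      moreover have "\<bar>(e i - wind i) * a.drift i\<bar> \<le> (int (2 * Y) * int n^2) * int (d * K)"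
        unfolding abs_mult using e[OF \<open>i \<in> {..<n}\<close>] a.drift_bound[of i]
        by (intro mult_mono) (auto simp: abs_minus_commute)
      moreover have "\<bar>s i + wind i * a.drift i\<bar> \<le> int (d * K)"
        using wind_le q(2) unfolding i_def by simp
      ultimately have "\<bar>?c\<bar> \<le> int (d * K) + (int (2 * Y) * int n^2) * int (d * K)" by linarith
      then show ?thesis unfolding S_def by simp
    qed
    have c_dvd: "int n dvd ?c" using s_dvd a.drift_dvd by simp
    have far: "int (x1 r) = int r + ?c" if r: "r \<ge> M + S" "r mod n = i" for r
    proof -
      \<comment> \<open>The point of the strip that is reached from \<open>r\<close> by removing as
        many whole drifts as possible.\<close>
      define p where "p = M + d * K + (r - (M + d * K)) mod (nat \<bar>a.drift i\<bar>)"
      have Sd: "S \<ge> d * K" unfolding S_def by simp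
      have Dpos: "nat \<bar>a.drift i\<bar> > 0" using q(2) unfolding i_def by simp
      have "(r - (M + d * K)) mod (nat \<bar>a.drift i\<bar>) \<le> d * K"
        using mod_less_divisor[OF Dpos, of "r - (M + d * K)"] a.drift_bound[of i] by linarith
      then have pP: "M + d * K \<le> p" "p \<le> M + 2 * (d * K)" unfolding p_def by linarith+
      define m where "m = (r - (M + d * K)) div (nat \<bar>a.drift i\<bar>)"
      have "r - (M + d * K) = m * nat \<bar>a.drift i\<bar> + (r - (M + d * K)) mod (nat \<bar>a.drift i\<bar>)"
        unfolding m_def by simp
      then have "r = p + m * nat \<bar>a.drift i\<bar>" unfolding p_def using r(1) Sd by linarith
      then have "int r = int p + int m * \<bar>a.drift i\<bar>" by simp
      then have rp: "int p = int r + (- int m * sgn (a.drift i)) * a.drift i"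
        by (simp add: abs_sgn ac_simps)
      have "zpow A (int d * (- int m * sgn (a.drift i))) r = p"
        by (rule a.zpow_drift) (use r pP rp in auto)
      moreover have pi: "p mod n = i"
        using a.mod_eq_dvd[OF rp] a.drift_dvd r(2) by simp
      moreover have "p \<in> P" unfolding P_def using pP pi q(2) unfolding i_def by simp
      ultimately have Er: "E r = e i" using E_P by metis
      define r' where "r' = nat (int r + ?c)"
      have r': "int r' = int r + ?c" using c r(1) unfolding r'_def by linarith
      then have "r' \<ge> M" using c r(1) by linarith
      have "zpow B (int d * e i) (x r) = r'"
        by (rule forced[OF _ _ \<open>r' \<ge> M\<close>]) (use r r' q(2) in \<open>auto simp: i_def\<close>)
      then show ?thesis unfolding x1_def Er using r' by simp
    qed
    have "int (x1 q) = int q + ?c" "int (x1 (q + n)) = int (q + n) + ?c"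
      using far[of q] far[of "q + n"] q(1) unfolding i_def by auto
    then show ?thesis using c a.mod_eq_dvd[OF _ c_dvd, of "x1 q" q] by auto
  qed
  ultimately show ?thesis by (rule that)
qed

end

section \<open>Conjugating finite orbits\<close>

text \<open>The value 0 for points that never return makes \<open>funpow_fixed_iff\<close> hold
  without exception, so infinite orbits count as one more period.\<close>

definition period :: "('a \<Rightarrow> 'a) \<Rightarrow> 'a \<Rightarrow> nat" where
  "period f q = (if \<exists>k>0. (f ^^ k) q = q then LEAST k. k > 0 \<and> (f ^^ k) q = q else 0)"

lemma funpow_fixed_iff: "(f ^^ k) q = q \<longleftrightarrow> period f q dvd k"
proof (cases "\<exists>k>0. (f ^^ k) q = q")
  case True
  define l where "l = period f q"
  have l: "l > 0" "(f ^^ l) q = q" and least: "\<And>k. k > 0 \<Longrightarrow> (f ^^ k) q = q \<Longrightarrow> l \<le> k"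
    using LeastI_ex[OF True] Least_le[of "\<lambda>k. k > 0 \<and> (f ^^ k) q = q"] True
    unfolding l_def period_def by auto
  have "(f ^^ (k mod l)) q = (f ^^ k) q" by (rule funpow_mod_eq[OF l(2)])
  moreover have "(f ^^ (k mod l)) q = q \<longleftrightarrow> k mod l = 0"
    using least[of "k mod l"] l(1) by (metis bot_nat_0.not_eq_extremum funpow_0 mod_less_divisor not_less)
  ultimately show ?thesis unfolding l_def[symmetric] by (simp add: dvd_eq_mod_eq_0)
next
  case False
  then have "period f q = 0" unfolding period_def by (rule if_not_P)
  moreover have "(f ^^ k) q = q \<longleftrightarrow> k = 0"
    using False by (metis funpow_0 neq0_conv)
  ultimately show ?thesis by simp
qed

lemma period_cong: "(\<And>k. (f ^^ k) q = q \<longleftrightarrow> (g ^^ k) r = r) \<Longrightarrow> period f q = period g r"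
  unfolding period_def by presburger

lemma funpow_inj:
  fixes f :: "'a \<Rightarrow> 'a"
  shows "bij f \<Longrightarrow> (f ^^ k) q = (f ^^ k) r \<longleftrightarrow> q = r"
  using zpow_inj[of f "int k" q r] by simp

lemma period_funpow: "bij f \<Longrightarrow> period f ((f ^^ j) q) = period f q"
proof (rule period_cong)
  fix k assume "bij f"
  have "(f ^^ k) ((f ^^ j) q) = (f ^^ j) ((f ^^ k) q)"
    by (metis add.commute comp_apply funpow_add)
  then show "(f ^^ k) ((f ^^ j) q) = (f ^^ j) q \<longleftrightarrow> (f ^^ k) q = q"
    using funpow_inj[OF \<open>bij f\<close>] by metis
qed

lemma period_intertwine:
  assumes "inj x" "\<And>q. x (f q) = g (x q)" shows "period g (x q) = period f q"
proof (rule period_cong)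
  fix k
  have "x ((f ^^ k) q) = (g ^^ k) (x q)" by (induction k) (simp_all add: assms(2))
  then show "(g ^^ k) (x q) = x q \<longleftrightarrow> (f ^^ k) q = q" using assms(1) by (metis injD)
qed

text \<open>Coincidences among iterates depend on the period alone. This makes a map sending
  \<open>(f ^^ k) s\<close> to \<open>(g ^^ k) (\<beta> s)\<close> well defined, and injective on
  each orbit.\<close>

lemma funpow_eq_transfer:
  assumes "bij f" "period f q = period g r" "(f ^^ j) q = (f ^^ k) q"
  shows "(g ^^ j) r = (g ^^ k) r"
proof -
  have *: "(g ^^ j) r = (g ^^ k) r" if jk: "j \<le> k" "(f ^^ j) q = (f ^^ k) q" for j k
  proof -
    have "k = j + (k - j)" using jk(1) by simp
    then have "(f ^^ j) ((f ^^ (k - j)) q) = (f ^^ j) q" using jk(2) by (metis comp_apply funpow_add)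
    then have "(f ^^ (k - j)) q = q" using funpow_inj[OF assms(1)] by blast
    then have "(g ^^ (k - j)) r = r" unfolding funpow_fixed_iff assms(2) .
    then show ?thesis using \<open>k = j + (k - j)\<close> by (metis comp_apply funpow_add)
  qed
  show ?thesis using *[of j k] *[of k j] assms(3) by (metis nat_le_linear)
qed

lemma funpow_return:
  assumes "period f q = l" "l > 0" "r = (f ^^ k) q" obtains m where "q = (f ^^ m) r"
proof
  \<comment> \<open>A multiple of the period that is at least \<open>k\<close> makes the subtraction
    below exact and avoids the inverse of \<open>f\<close>.\<close>
  have "k \<le> l * k" using assms(2) by simp
  then have "(f ^^ (l * k - k)) r = (f ^^ (l * k)) q"
    unfolding assms(3) by (metis comp_apply funpow_add le_add_diff_inverse2)
  also have "\<dots> = q" unfolding funpow_fixed_iff assms(1) by simp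
  finally show "q = (f ^^ (l * k - k)) r" by simp
qed

text \<open>A transversal of the orbits of length \<open>l\<close>. Forward iterates suffice to
  express this, since for \<open>l > 0\<close> they run through the whole orbit.\<close>

definition is_section :: "('a \<Rightarrow> 'a) \<Rightarrow> nat \<Rightarrow> 'a set \<Rightarrow> bool" where
  "is_section f l S \<longleftrightarrow> (\<forall>s\<in>S. period f s = l) \<and> (\<forall>q. period f q = l \<longrightarrow> (\<exists>s\<in>S. \<exists>k. q = (f ^^ k) s))
     \<and> (\<forall>s\<in>S. \<forall>k. (f ^^ k) s \<in> S \<longrightarrow> (f ^^ k) s = s)"

lemma section_unique:
  assumes "is_section f l S" "l > 0" "s \<in> S" "t \<in> S" "(f ^^ j) s = (f ^^ k) t" shows "s = t"
proof -
  have "period f t = l" using assms(1,4) unfolding is_section_def by blast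
  then obtain m where "t = (f ^^ m) ((f ^^ j) s)" using funpow_return[of f t l _ k] assms(2,5) by metis
  then have "t = (f ^^ (m + j)) s" by (simp add: funpow_add)
  then show ?thesis using assms(1,3,4) unfolding is_section_def by metis
qed

lemma extend_section_bijection:
  assumes f: "bij f" and g: "bij g" and l: "l > 0"
    and S: "is_section f l S" and T: "is_section g l T" and \<beta>: "bij_betw \<beta> S T"
  obtains y where "bij_betw y {q. period f q = l} {q. period g q = l}"
    "\<And>q. period f q = l \<Longrightarrow> y (f q) = g (y q)"
    "\<And>s k. s \<in> S \<Longrightarrow> y ((f ^^ k) s) = (g ^^ k) (\<beta> s)"
proof -
  have perS: "period f s = l" if "s \<in> S" for s using S that unfolding is_section_def by blast
  have covS: "\<exists>s\<in>S. \<exists>k. q = (f ^^ k) s" if "period f q = l" for q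
    using S that unfolding is_section_def by blast
  have perT: "period g s = l" if "s \<in> T" for s using T that unfolding is_section_def by blast
  have covT: "\<exists>s\<in>T. \<exists>k. q = (g ^^ k) s" if "period g q = l" for q
    using T that unfolding is_section_def by blast
  have \<beta>T: "\<beta> s \<in> T" if "s \<in> S" for s using \<beta> that by (meson bij_betwE)
  \<comment> \<open>The representative in such a pair is unique and the exponent is unique modulo
    \<open>l\<close>, so the choice does not affect \<open>y\<close>.\<close>
  define c where "c q = (SOME p. fst p \<in> S \<and> q = (f ^^ snd p) (fst p))" for q
  define y where "y q = (g ^^ snd (c q)) (\<beta> (fst (c q)))" for q
  have y: "y ((f ^^ k) s) = (g ^^ k) (\<beta> s)" if s: "s \<in> S" for s k
  proof -
    define p where "p = c ((f ^^ k) s)"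
    have p: "fst p \<in> S" "(f ^^ k) s = (f ^^ snd p) (fst p)"
      unfolding p_def c_def
      using someI[of "\<lambda>p. fst p \<in> S \<and> (f ^^ k) s = (f ^^ snd p) (fst p)" "(s, k)"] s by auto
    have "s = fst p" by (rule section_unique[OF S l s p])
    moreover then have "(f ^^ k) s = (f ^^ snd p) s" using p(2) by simp
    then have "(g ^^ k) (\<beta> s) = (g ^^ snd p) (\<beta> s)"
      using funpow_eq_transfer[OF f] perS[OF s] perT[OF \<beta>T[OF s]] by metis
    ultimately show ?thesis unfolding y_def p_def[symmetric] by simp
  qed
  have "bij_betw y {q. period f q = l} {q. period g q = l}"
    unfolding bij_betw_def
  proof
    show "inj_on y {q. period f q = l}"
    proof (rule inj_onI)
      fix q r assume "q \<in> {q. period f q = l}" "r \<in> {q. period f q = l}" and eq: "y q = y r"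
      then obtain s j t k where s: "s \<in> S" "q = (f ^^ j) s" and t: "t \<in> S" "r = (f ^^ k) t"
        using covS by blast
      have e: "(g ^^ j) (\<beta> s) = (g ^^ k) (\<beta> t)" using eq y s t by simp
      have "\<beta> s = \<beta> t" by (rule section_unique[OF T l \<beta>T[OF s(1)] \<beta>T[OF t(1)] e])
      then have st: "s = t" using \<beta> s(1) t(1) by (metis bij_betw_def inj_onD)
      then show "q = r"
        using funpow_eq_transfer[OF g _ e[unfolded st], of f s] perS[OF s(1)] perT[OF \<beta>T[OF s(1)]] s t
        by metis
    qed
    show "y ` {q. period f q = l} = {q. period g q = l}"
    proof (intro set_eqI iffI)
      fix r assume "r \<in> y ` {q. period f q = l}"
      then obtain q where q: "period f q = l" "r = y q" by blast
      then obtain s k where s: "s \<in> S" "q = (f ^^ k) s" using covS by blast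
      then show "r \<in> {q. period g q = l}"
        using q(2) y period_funpow[OF g] perT \<beta>T by simp
    next
      fix r assume "r \<in> {q. period g q = l}"
      then obtain t k where t: "t \<in> T" "r = (g ^^ k) t" using covT by blast
      obtain s where s: "s \<in> S" "t = \<beta> s" using \<beta> t(1) unfolding bij_betw_def by blast
      have "r = y ((f ^^ k) s)" using y s t by simp
      moreover have "period f ((f ^^ k) s) = l" using period_funpow[OF f] perS s(1) by metis
      ultimately show "r \<in> y ` {q. period f q = l}" by blast
    qed
  qed
  moreover have "y (f q) = g (y q)" if "period f q = l" for q
  proof -
    obtain s k where s: "s \<in> S" "q = (f ^^ k) s" using covS \<open>period f q = l\<close> by blast
    then show ?thesis using y[OF s(1), of k] y[OF s(1), of "Suc k"] by simp
  qed
  ultimately show ?thesis using y by (rule that)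
qed

text \<open>Orbits are ordered first by residue, so that the representative of an orbit far out
  is determined by residues alone.\<close>

definition orbit_minima :: "nat \<Rightarrow> (nat \<Rightarrow> nat) \<Rightarrow> nat \<Rightarrow> nat set" where
  "orbit_minima n f l = {q. period f q = l \<and>
     (\<forall>k. q mod n < (f ^^ k) q mod n \<or> q mod n = (f ^^ k) q mod n \<and> q \<le> (f ^^ k) q)}"

text \<open>Existence comes from well-foundedness of the lexicographic order by residue and value,
  uniqueness from its antisymmetry: two minima of one orbit lie below each other.\<close>

lemma is_section_orbit_minima:
  assumes f: "bij f" and l: "l > 0" shows "is_section f l (orbit_minima n f l)"
  unfolding is_section_def
proof (intro conjI ballI allI impI)
  fix s assume "s \<in> orbit_minima n f l"
  then show "period f s = l" unfolding orbit_minima_def by blast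
next
  fix q assume q: "period f q = l"
  let ?O = "range (\<lambda>k. (f ^^ k) q)"
  obtain z where z: "z \<in> ?O" and min: "\<And>r. (r, z) \<in> measures [\<lambda>q. q mod n, \<lambda>q. q] \<Longrightarrow> r \<notin> ?O"
    using wfE_min[OF wf_measures, of "(f ^^ 0) q" ?O] by blast
  obtain k where k: "z = (f ^^ k) q" using z by blast
  have "z mod n < (f ^^ j) z mod n \<or> z mod n = (f ^^ j) z mod n \<and> z \<le> (f ^^ j) z" for j
  proof -
    have "(f ^^ j) z = (f ^^ (j + k)) q" unfolding k by (simp add: funpow_add)
    then have "(f ^^ j) z \<in> ?O" by blast
    then have "((f ^^ j) z, z) \<notin> measures [\<lambda>q. q mod n, \<lambda>q. q]" using min by blast
    then show ?thesis by auto
  qed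
  then have "z \<in> orbit_minima n f l" using period_funpow[OF f] q k unfolding orbit_minima_def by simp
  moreover obtain m where "q = (f ^^ m) z" using funpow_return[OF q l k] .
  ultimately show "\<exists>s\<in>orbit_minima n f l. \<exists>k. q = (f ^^ k) s" by blast
next
  fix s k assume s: "s \<in> orbit_minima n f l" and t: "(f ^^ k) s \<in> orbit_minima n f l"
  have "period f s = l" using s unfolding orbit_minima_def by blast
  then obtain m where m: "s = (f ^^ m) ((f ^^ k) s)" using funpow_return[OF _ l refl] by metis
  have "s mod n < (f ^^ k) s mod n \<or> s mod n = (f ^^ k) s mod n \<and> s \<le> (f ^^ k) s"
    using s unfolding orbit_minima_def by blast
  moreover have "(f ^^ k) s mod n < (f ^^ m) ((f ^^ k) s) mod n
      \<or> (f ^^ k) s mod n = (f ^^ m) ((f ^^ k) s) mod n \<and> (f ^^ k) s \<le> (f ^^ m) ((f ^^ k) s)"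
    using t unfolding orbit_minima_def by blast
  then have "(f ^^ k) s mod n < s mod n \<or> (f ^^ k) s mod n = s mod n \<and> (f ^^ k) s \<le> s"
    unfolding m[symmetric] .
  ultimately show "(f ^^ k) s = s" by auto
qed

text \<open>\<open>S\<close> and \<open>T\<close> may have different numbers of points below \<open>Y\<close>; the difference is absorbed
  by shifting the single column of residue \<open>i\<close>.\<close>

lemma tail_bijection:
  fixes S T :: "nat set"
  assumes n: "n > 0" and Y: "n dvd Y" and i: "i < n"
    and ST: "\<And>q. q \<ge> Y \<Longrightarrow> q \<in> S \<longleftrightarrow> q \<in> T"
    and per: "\<And>q. q \<ge> Y \<Longrightarrow> q + n \<in> S \<longleftrightarrow> q \<in> S"
    and YS: "Y + i \<in> S"
  obtains \<beta> where "bij_betw \<beta> S T"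
    "\<And>q. q \<in> S \<Longrightarrow> q \<ge> Y + n * Y + n \<Longrightarrow>
       \<beta> (q + n) = \<beta> q + n \<and> \<beta> q mod n = q mod n \<and> \<beta> q \<le> q + n * Y \<and> q \<le> \<beta> q + n * Y"
proof -
  define a b where "a = card (S \<inter> {..<Y})" and "b = card (T \<inter> {..<Y})"
  define col where "col u = Y + i + n * u" for u
  have aY: "a \<le> Y" "b \<le> Y"
    unfolding a_def b_def using card_mono[of "{..<Y}"] by (metis card_lessThan finite_lessThan inf_le2)+
  have col_S: "col u \<in> S" for u
  proof (induction u)
    case (Suc u)
    then show ?case using per[of "col u"] unfolding col_def by (simp add: algebra_simps)
  qed (simp add: col_def YS)
  have col_Y: "col u \<ge> Y" for u unfolding col_def by simp
  then have col_T: "col u \<in> T" for u using col_S ST by blast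
  have inj_col: "inj col" unfolding col_def using n by (intro injI) simp
  have col_mod: "col u mod n = i" for u using Y i unfolding col_def by (auto elim!: dvdE)
  have colE: "\<exists>u. q = col u" if q: "q \<ge> Y" "q mod n = i" for q
  proof -
    have "(q - Y) mod n = i"
      using q Y by (metis add.right_neutral dvd_imp_mod_0 le_add_diff_inverse mod_add_left_eq add_0)
    then have "q - Y = i + n * ((q - Y) div n)" by (metis add.commute mult_div_mod_eq)
    then have "q = col ((q - Y) div n)" using q(1) unfolding col_def by linarith
    then show ?thesis ..
  qed
  \<comment> \<open>Each low part is enlarged by as many column points as the other low part has
    elements. Both then have \<open>a + b\<close> elements and any bijection between them will do;
    the rest of the column is matched by moving it \<open>a - b\<close> places.\<close>
  define L L' where "L = (S \<inter> {..<Y}) \<union> col ` {..<b}" and "L' = (T \<inter> {..<Y}) \<union> col ` {..<a}"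
  have disj: "A \<inter> {..<Y} \<inter> col ` C = {}" for A C using col_Y by (auto simp flip: not_le)
  have cc: "card (col ` {..<k}) = k" for k using inj_col by (simp add: card_image inj_on_subset)
  have "card L = a + b" "card L' = b + a" unfolding L_def L'_def a_def b_def
    by (subst card_Un_disjoint[OF _ _ disj]; simp add: cc)+
  moreover have "finite L" "finite L'" unfolding L_def L'_def by auto
  ultimately obtain \<gamma> where \<gamma>: "bij_betw \<gamma> L L'" using finite_same_card_bij[of L L'] by auto
  have inL: "q \<in> L \<longleftrightarrow> q < Y \<or> (\<exists>u<b. q = col u)" if "q \<in> S" for q
    unfolding L_def using that by auto
  have inL': "q \<in> L' \<longleftrightarrow> q < Y \<or> (\<exists>u<a. q = col u)" if "q \<in> T" for q
    unfolding L'_def using that by auto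
  define h where "h q = (if q mod n = i then q + n * a - n * b else q)" for q
  define h' where "h' q = (if q mod n = i then q + n * b - n * a else q)" for q
  have col_add: "col u + n * v - n * w = col (u + v - w)" if "w \<le> u + v" for u v w
  proof -
    have "n * u + n * v = n * w + n * (u + v - w)" using that
      by (metis add_mult_distrib2 le_add_diff_inverse)
    then show ?thesis unfolding col_def by simp
  qed
  have h_col: "h (col u) = col (u + a - b)" if "u \<ge> b" for u
    unfolding h_def using col_mod col_add[of b u a] that by simp
  have h'_col: "h' (col u) = col (u + b - a)" if "u \<ge> a" for u
    unfolding h'_def using col_mod col_add[of a u b] that by simp
  have high: "q \<ge> Y \<and> (q mod n \<noteq> i \<or> (\<exists>u\<ge>b. q = col u))" if "q \<in> S - L" for q
    using that inL[of q] colE[of q] by (metis DiffE not_le)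
  have high': "q \<ge> Y \<and> (q mod n \<noteq> i \<or> (\<exists>u\<ge>a. q = col u))" if "q \<in> T - L'" for q
    using that inL'[of q] colE[of q] by (metis DiffE not_le)
  have hb: "bij_betw h (S - L) (T - L')"
  proof (rule bij_betw_byWitness[where f' = h'])
    show "\<forall>q\<in>S - L. h' (h q) = q"
    proof
      fix q assume "q \<in> S - L"
      then consider "q mod n \<noteq> i" | u where "u \<ge> b" "q = col u" using high by blast
      then show "h' (h q) = q" by cases (auto simp: h_col h'_col, auto simp: h_def h'_def)
    qed
    show "\<forall>q\<in>T - L'. h (h' q) = q"
    proof
      fix q assume "q \<in> T - L'"
      then consider "q mod n \<noteq> i" | u where "u \<ge> a" "q = col u" using high' by blast
      then show "h (h' q) = q" by cases (auto simp: h_col h'_col, auto simp: h_def h'_def)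
    qed
    show "h ` (S - L) \<subseteq> T - L'"
    proof
      fix r assume "r \<in> h ` (S - L)"
      then obtain q where q: "q \<in> S - L" "r = h q" by blast
      from high[OF q(1)] consider "q \<ge> Y" "q mod n \<noteq> i" | u where "u \<ge> b" "q = col u" by blast
      then show "r \<in> T - L'"
      proof cases
        case 1
        then have "r = q" using q(2) unfolding h_def by simp
        moreover have "q \<in> T" using ST 1(1) q(1) by blast
        ultimately show ?thesis using inL'[of q] 1 col_mod by auto
      next
        case 2
        then have "r = col (u + a - b)" using q(2) h_col by simp
        moreover have "u + a - b \<ge> a" using 2(1) by simp
        ultimately show ?thesis using inL'[of r] col_T col_Y inj_col
          by (auto simp: not_less inj_eq)
      qed
    qed
    show "h' ` (T - L') \<subseteq> S - L"
    proof
      fix r assume "r \<in> h' ` (T - L')"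
      then obtain q where q: "q \<in> T - L'" "r = h' q" by blast
      from high'[OF q(1)] consider "q \<ge> Y" "q mod n \<noteq> i" | u where "u \<ge> a" "q = col u" by blast
      then show "r \<in> S - L"
      proof cases
        case 1
        then have "r = q" using q(2) unfolding h'_def by simp
        moreover have "q \<in> S" using ST 1(1) q(1) by blast
        ultimately show ?thesis using inL[of q] 1 col_mod by auto
      next
        case 2
        then have "r = col (u + b - a)" using q(2) h'_col by simp
        moreover have "u + b - a \<ge> b" using 2(1) by simp
        ultimately show ?thesis using inL[of r] col_S col_Y inj_col
          by (auto simp: not_less inj_eq)
      qed
    qed
  qed
  define \<beta> where "\<beta> q = (if q \<in> L then \<gamma> q else h q)" for q
  have LS: "L \<subseteq> S" "L' \<subseteq> T" unfolding L_def L'_def using col_S col_T by auto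
  have "bij_betw \<beta> (L \<union> (S - L)) (L' \<union> (T - L'))"
  proof (rule bij_betw_combine)
    show "bij_betw \<beta> L L'" using \<gamma> by (rule bij_betw_cong[THEN iffD1, rotated]) (simp add: \<beta>_def)
    show "bij_betw \<beta> (S - L) (T - L')" using hb by (rule bij_betw_cong[THEN iffD1, rotated]) (simp add: \<beta>_def)
  qed auto
  moreover have "L \<union> (S - L) = S" "L' \<union> (T - L') = T" using LS by auto
  ultimately have "bij_betw \<beta> S T" by simp
  moreover have "\<beta> (q + n) = \<beta> q + n \<and> \<beta> q mod n = q mod n \<and> \<beta> q \<le> q + n * Y \<and> q \<le> \<beta> q + n * Y"
    if q: "q \<in> S" "q \<ge> Y + n * Y + n" for q
  proof -
    have nab: "n * a \<le> n * Y" "n * b \<le> n * Y" using aY by simp_all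
    have notL: "r \<notin> L" if r: "r \<in> S" "r \<ge> Y + n * Y + n" for r
    proof
      assume "r \<in> L"
      then obtain u where u: "u < b" "r = col u" using inL[OF r(1)] r(2) by auto
      have "n * u \<le> n * b" using u(1) by simp
      then show False using r(2) u(2) nab(2) i unfolding col_def by linarith
    qed
    have "q + n \<in> S" using per[of q] q by simp
    then have \<beta>q: "\<beta> q = h q" "\<beta> (q + n) = h (q + n)" using notL q unfolding \<beta>_def by simp_all
    have "(q + n * a - n * b) mod n = q mod n"
    proof -
      have "int (q + n * a - n * b) = int q + (int n * int a - int n * int b)"
      proof -
        have "n * b \<le> q + n * a" using q(2) nab by linarith
        then show ?thesis by (simp add: of_nat_diff)
      qed
      moreover have "int n dvd int n * int a - int n * int b" by simp
      ultimately show ?thesis by (metis add_diff_cancel_left' mod_eq_dvd_iff of_nat_eq_iff of_nat_mod)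
    qed
    moreover have "q + n + n * a - n * b = q + n * a - n * b + n"
      "q + n * a - n * b \<le> q + n * Y" "q \<le> q + n * a - n * b + n * Y"
      using q(2) nab by linarith+
    ultimately show ?thesis unfolding \<beta>q h_def by simp
  qed
  ultimately show ?thesis by (rule that)
qed

section \<open>Periods and orbit representatives far out\<close>

context quasi_periodic_map
begin

lemma moving_period: "q \<ge> M \<Longrightarrow> drift (q mod n) \<noteq> 0 \<Longrightarrow> period A q = 0"
  using moving_not_fixed[of q "int (period A q)"] funpow_fixed_iff[of "period A q" A q] by simp

lemma static_period: "q \<ge> M \<Longrightarrow> drift (q mod n) = 0 \<Longrightarrow> period A q dvd d"
  using pow_d_drift[of q] by (simp add: funpow_fixed_iff[symmetric])

lemma period_le_d: "q \<ge> M \<Longrightarrow> period A q \<le> d"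
  using moving_period[of q] static_period[of q] d_pos by (metis dvd_imp_le le0)

text \<open>Far moving points all have period 0. On a static residue \<open>A ^^ d\<close> is the
  identity, so exponents may be reduced modulo \<open>d\<close>, and for those the displacement
  depends on the residue alone.\<close>

lemma period_mod:
  assumes "q \<ge> M" "r \<ge> M" "q mod n = r mod n" shows "period A q = period A r"
proof (cases "drift (q mod n) = 0")
  case False
  then show ?thesis using moving_period assms by simp
next
  case True
  have fx: "(A ^^ d) q = q" "(A ^^ d) r = r"
    unfolding funpow_fixed_iff using static_period assms True by simp_all
  show ?thesis
  proof (rule period_cong)
    fix k
    have "k mod d \<le> d" using d_pos by (simp add: less_imp_le)
    then have "int ((A ^^ (k mod d)) q) - int q = int ((A ^^ (k mod d)) r) - int r"
      using pow_displacement le_M assms by blast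
    then have "(A ^^ (k mod d)) q = q \<longleftrightarrow> (A ^^ (k mod d)) r = r" by auto
    then show "(A ^^ k) q = q \<longleftrightarrow> (A ^^ k) r = r"
      using funpow_mod_eq[OF fx(1), of k] funpow_mod_eq[OF fx(2), of k] by simp
  qed
qed

text \<open>An iterate that returned to its residue class too early would translate that class by
  some \<open>\<delta>\<close>. Doing this \<open>l\<close> times translates by
  \<open>l * \<delta>\<close>, which must be 0 because \<open>l\<close> is the period; so the orbit
  would already have closed after \<open>k\<close> steps.\<close>

lemma residue_moves:
  assumes q: "q \<ge> M" and k: "0 < k" "k < period A q" shows "(A ^^ k) q mod n \<noteq> q mod n"
proof
  assume eq: "(A ^^ k) q mod n = q mod n"
  define l where "l = period A q"
  define \<delta> where "\<delta> = int ((A ^^ k) q) - int q"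
  have \<delta>_dvd: "int n dvd \<delta>" using eq unfolding \<delta>_def by (metis mod_eq_dvd_iff of_nat_mod)
  \<comment> \<open>Same residue as \<open>q\<close>, but high enough for \<open>l\<close>
    translations by \<open>\<delta>\<close>, possibly downward, to stay at or above
    \<open>q\<close>.\<close>
  define q0 where "q0 = q + n * (l * nat \<bar>\<delta>\<bar>)"
  have "1 * (l * nat \<bar>\<delta>\<bar>) \<le> n * (l * nat \<bar>\<delta>\<bar>)" using n_pos by (intro mult_le_mono1) simp
  then have "int (l * nat \<bar>\<delta>\<bar>) \<le> int (n * (l * nat \<bar>\<delta>\<bar>))" unfolding zle_int by simp
  then have q0: "int q0 \<ge> int q + int l * \<bar>\<delta>\<bar>" unfolding q0_def by simp
  have kK: "k * K \<le> q" using le_M[OF _ q, of k] k(2) period_le_d[OF q] by simp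
  have pow: "j \<le> l \<Longrightarrow> int ((A ^^ (k * j)) q0) = int q0 + int j * \<delta>" for j
  proof (induction j)
    case (Suc j)
    let ?m = "(A ^^ (k * j)) q0"
    have m: "int ?m = int q0 + int j * \<delta>" using Suc by simp
    have "int j * \<bar>\<delta>\<bar> \<le> int l * \<bar>\<delta>\<bar>" using Suc.prems by (intro mult_right_mono) auto
    moreover have "\<bar>int j * \<delta>\<bar> = int j * \<bar>\<delta>\<bar>" by (simp add: abs_mult)
    ultimately have "?m \<ge> q" using m q0 by linarith
    moreover have "?m mod n = q mod n"
      using mod_eq_dvd[OF m] \<delta>_dvd unfolding q0_def by simp
    ultimately have "int ((A ^^ k) ?m) - int ?m = \<delta>"
      using pow_displacement[of k ?m q] kK unfolding \<delta>_def by simp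
    moreover have "(A ^^ (k * Suc j)) q0 = (A ^^ k) ?m" by (simp add: funpow_add)
    ultimately show ?case using m by (simp add: algebra_simps)
  qed simp
  have "q0 \<ge> M" using q unfolding q0_def by simp
  then have "period A q0 = l" using period_mod[of q0 q] q unfolding q0_def l_def by simp
  then have "(A ^^ (k * l)) q0 = q0" unfolding funpow_fixed_iff by simp
  then have "int l * \<delta> = 0" using pow[of l] by simp
  then have "\<delta> = 0" using k unfolding l_def by simp
  then have "(A ^^ k) q = q" unfolding \<delta>_def by simp
  then have "period A q dvd k" unfolding funpow_fixed_iff .
  then show False using k by (simp add: nat_dvd_not_less)
qed

text \<open>A tie of residues before the orbit closes would contradict \<open>residue_moves\<close>,
  so the comparison of values drops out.\<close>

lemma orbit_minima_far:
  assumes q: "q \<ge> M" and l: "l > 0"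
  shows "q \<in> orbit_minima n A l \<longleftrightarrow> period A q = l \<and> (\<forall>k. 0 < k \<and> k < l \<longrightarrow> q mod n < (A ^^ k) q mod n)"
    (is "?L \<longleftrightarrow> ?R")
proof
  assume ?L
  then show ?R using residue_moves[OF q] unfolding orbit_minima_def by (simp, metis)
next
  assume R: ?R
  then have fx: "(A ^^ l) q = q" unfolding funpow_fixed_iff by simp
  have "q mod n < (A ^^ k) q mod n \<or> q mod n = (A ^^ k) q mod n \<and> q \<le> (A ^^ k) q" for k
  proof (cases "k mod l = 0")
    case True
    then show ?thesis using funpow_mod_eq[OF fx, of k] by simp
  next
    case False
    then show ?thesis using funpow_mod_eq[OF fx, of k] R l by (metis bot_nat_0.not_eq_extremum mod_less_divisor)
  qed
  then show ?L using R unfolding orbit_minima_def by blast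
qed

lemma orbit_minima_mod:
  assumes "q \<ge> M" "r \<ge> M" "q mod n = r mod n" "l > 0"
  shows "q \<in> orbit_minima n A l \<longleftrightarrow> r \<in> orbit_minima n A l"
proof -
  have "(A ^^ k) q mod n = (A ^^ k) r mod n" if "k < period A q" for k
    using pow_mod[of k q r] le_M[of k] assms that period_le_d[of q] by simp
  then show ?thesis using orbit_minima_far assms period_mod[OF assms(1-3)] by auto
qed

end

section \<open>Rebuilding the conjugator on finite orbits\<close>

context conjugate_pair
begin

text \<open>From \<open>M\<close> on, the period of a point and the residues of its first
  \<open>d\<close> iterates depend on its residue alone. They can be compared for \<open>A\<close>
  and \<open>B\<close> at this far point, where \<open>x\<close> is a translation, and the result
  then holds from \<open>M\<close> on, whatever \<open>Z\<close> is.\<close>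

lemma far_representative:
  obtains r where "r mod n = q mod n" "r \<ge> M" "r \<ge> Z" "x r \<ge> M" "x r mod n = q mod n"
    "\<And>k. k \<le> d \<Longrightarrow> (A ^^ k) r \<ge> Z"
proof -
  have "q mod n < n" using a.n_pos by simp
  then obtain r where r: "r \<ge> Z + M + d * K + nat \<bar>s (q mod n)\<bar>" "r mod n = q mod n"
    using far_point by blast
  have rZ: "r \<ge> Z" using r(1) by simp
  have "int (x r) = int r + s (q mod n)" using x_s[OF rZ] r(2) by simp
  then have "x r \<ge> M" using r(1) by linarith
  moreover have "(A ^^ k) r \<ge> Z" if "k \<le> d" for k
    using a.pow_le(2)[of r k] mult_le_mono1[OF that, of K] r(1) by linarith
  ultimately show ?thesis using that r x_mod[OF rZ] by simp
qed

lemma period_eq: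
  assumes "q \<ge> M" shows "period A q = period B q"
proof -
  obtain r where r: "r mod n = q mod n" "r \<ge> M" "x r \<ge> M" "x r mod n = q mod n"
    by (rule far_representative[of q]) (rule that; assumption)
  have "period A q = period A r" by (rule a.period_mod[OF assms r(2) r(1)[symmetric]])
  also have "\<dots> = period B (x r)" using period_intertwine[of x A B r] x_bij x_A by (simp add: bij_is_inj)
  also have "\<dots> = period B q" by (rule b.period_mod[OF r(3) assms r(4)])
  finally show ?thesis .
qed

lemma pow_mod_eq:
  assumes "q \<ge> M" "k \<le> d" shows "(A ^^ k) q mod n = (B ^^ k) q mod n"
proof -
  obtain r where r: "r mod n = q mod n" "r \<ge> M" "x r \<ge> M" "x r mod n = q mod n" "(A ^^ k) r \<ge> Z"
    by (rule far_representative[of q]) (use assms(2) in blast)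
  have "(A ^^ k) q mod n = (A ^^ k) r mod n"
    by (rule a.pow_mod[OF a.le_M[OF assms(2,1)] a.le_M[OF assms(2) r(2)] r(1)[symmetric]])
  also have "\<dots> = x ((A ^^ k) r) mod n" using x_mod r(5) by simp
  also have "\<dots> = (B ^^ k) (x r) mod n" using x_pow by simp
  also have "\<dots> = (B ^^ k) q mod n"
    by (rule b.pow_mod[OF b.le_M[OF assms(2) r(3)] b.le_M[OF assms(2,1)] r(4)])
  finally show ?thesis .
qed

lemma orbit_minima_eq:
  assumes "q \<ge> M" "l > 0" shows "q \<in> orbit_minima n A l \<longleftrightarrow> q \<in> orbit_minima n B l"
proof -
  have "(A ^^ k) q mod n = (B ^^ k) q mod n" if "k < period A q" for k
    using pow_mod_eq[OF assms(1)] a.period_le_d[OF assms(1)] that by simp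
  then show ?thesis
    using a.orbit_minima_far b.orbit_minima_far assms period_eq[OF assms(1)] by auto
qed

text \<open>\<open>n * M\<close> plays the part of \<open>Y\<close> in
  \<open>tail_bijection\<close>, whose threshold gives the first three summands. The last one covers
  two walks along orbits, of at most \<open>d * K\<close> each: from \<open>q\<close> to its
  representative, and from the image of the representative to the image of \<open>q\<close>.\<close>

definition R :: nat where "R = n * M + n * (n * M) + n + 2 * (d * K)"

lemma rebuild_static:
  assumes l: "l > 0" and q0: "q0 \<ge> M" "period A q0 = l"
  obtains y where "bij_betw y {q. period A q = l} {q. period B q = l}"
    "\<And>q. period A q = l \<Longrightarrow> y (A q) = B (y q)"
    "\<And>q. period A q = l \<Longrightarrow> q \<ge> R \<Longrightarrow>
       y (q + n) = y q + n \<and> y q mod n = q mod n \<and> \<bar>int (y q) - int q\<bar> \<le> int R"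
proof -
  have nM: "n * M \<ge> M" using a.nM[of 0] by simp
  have reach: "\<exists>s\<in>orbit_minima n A l. \<exists>k<l. q = (A ^^ k) s \<and> k * K \<le> d * K \<and> q \<le> s + d * K \<and> s \<le> q + d * K"
    if q: "period A q = l" "l \<le> d" for q
  proof -
    obtain s m where s: "s \<in> orbit_minima n A l" "q = (A ^^ m) s"
      using is_section_orbit_minima[OF a.bij l] q(1) unfolding is_section_def by blast
    then have "period A s = l" unfolding orbit_minima_def by blast
    then have "(A ^^ l) s = s" unfolding funpow_fixed_iff by simp
    then have "q = (A ^^ (m mod l)) s" using funpow_mod_eq[of l A s m] s(2) by simp
    moreover have kl: "m mod l < l" using l by simp
    moreover have "(m mod l) * K \<le> d * K" using kl q(2) by (intro mult_le_mono1) linarith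
    moreover have "q \<le> s + d * K" "s \<le> q + d * K"
      using a.pow_le[where q = s and k = "m mod l"] calculation by linarith+
    ultimately show ?thesis using s(1) by blast
  qed
  have ld: "l \<le> d" using a.period_le_d[OF q0(1)] q0(2) by simp
  \<comment> \<open>A period seen beyond \<open>M\<close> recurs along a whole residue class, so it
    has a representative above \<open>M\<close>; the residue of that representative supplies the
    column needed by \<open>tail_bijection\<close>.\<close>
  obtain i where i: "i < n" "n * M + i \<in> orbit_minima n A l"
  proof -
    have "q0 mod n < n" using a.n_pos by simp
    then obtain q where q: "q \<ge> n * M + d * K" "q mod n = q0 mod n" using far_point by blast
    have "period A q = l" using a.period_mod[of q q0] q q0 nM by simp
    then obtain s where s: "s \<in> orbit_minima n A l" "q \<le> s + d * K" using reach ld by blast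
    then have "s \<ge> M" using q(1) nM by linarith
    then have "n * M + s mod n \<in> orbit_minima n A l"
      using a.orbit_minima_mod[of s "n * M + s mod n" l] s(1) l nM by simp
    then show ?thesis using that[of "s mod n"] a.n_pos by simp
  qed
  obtain \<beta> where \<beta>: "bij_betw \<beta> (orbit_minima n A l) (orbit_minima n B l)"
    "\<And>q. q \<in> orbit_minima n A l \<Longrightarrow> q \<ge> n * M + n * (n * M) + n \<Longrightarrow>
       \<beta> (q + n) = \<beta> q + n \<and> \<beta> q mod n = q mod n \<and> \<beta> q \<le> q + n * (n * M) \<and> q \<le> \<beta> q + n * (n * M)"
  proof (rule tail_bijection[of n "n * M" i "orbit_minima n A l" "orbit_minima n B l"])
    show "q \<in> orbit_minima n A l \<longleftrightarrow> q \<in> orbit_minima n B l" if "n * M \<le> q" for q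
      by (rule orbit_minima_eq[OF le_trans[OF nM that] l])
    show "q + n \<in> orbit_minima n A l \<longleftrightarrow> q \<in> orbit_minima n A l" if "n * M \<le> q" for q
      using a.orbit_minima_mod[of "q + n" q l] l that nM by simp
  qed (use a.n_pos i in auto)
  obtain y where y: "bij_betw y {q. period A q = l} {q. period B q = l}"
    "\<And>q. period A q = l \<Longrightarrow> y (A q) = B (y q)"
    "\<And>s k. s \<in> orbit_minima n A l \<Longrightarrow> y ((A ^^ k) s) = (B ^^ k) (\<beta> s)"
    using extend_section_bijection[OF a.bij b.bij l is_section_orbit_minima[OF a.bij l]
        is_section_orbit_minima[OF b.bij l] \<beta>(1)] by blast
  have "y (q + n) = y q + n \<and> y q mod n = q mod n \<and> \<bar>int (y q) - int q\<bar> \<le> int R"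
    if q: "period A q = l" "q \<ge> R" for q
  proof -
    obtain s k where s: "s \<in> orbit_minima n A l" and k: "k < l" "q = (A ^^ k) s" "k * K \<le> d * K"
      and qs: "q \<le> s + d * K" "s \<le> q + d * K" using reach[OF q(1) ld] by blast
    have sR: "s \<ge> n * M + n * (n * M) + n + d * K" using q(2) qs unfolding R_def by linarith
    then have \<beta>s: "\<beta> (s + n) = \<beta> s + n" "\<beta> s mod n = s mod n" "\<beta> s \<le> s + n * (n * M)" "s \<le> \<beta> s + n * (n * M)"
      using \<beta>(2)[OF s] by auto
    have big: "s \<ge> M" "\<beta> s \<ge> M" "s \<ge> d * K" "\<beta> s \<ge> d * K" using sR \<beta>s(4) nM by linarith+
    have kd: "k \<le> d" using k(1) ld by simp
    have "s + n \<in> orbit_minima n A l" using a.orbit_minima_mod[of "s + n" s l] s big l by simp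
    moreover have "q + n = (A ^^ k) (s + n)" using a.pow_shift[of k s] k(2,3) big(3) by simp
    ultimately have "y (q + n) = (B ^^ k) (\<beta> s + n)" using y(3) \<beta>s(1) by simp
    also have "\<dots> = (B ^^ k) (\<beta> s) + n" using b.pow_shift[of k "\<beta> s"] k(3) big(4) by simp
    finally have 1: "y (q + n) = y q + n" using y(3)[OF s] k(2) by simp
    have yq: "y q = (B ^^ k) (\<beta> s)" using y(3)[OF s] k(2) by simp
    have "(B ^^ k) (\<beta> s) mod n = (B ^^ k) s mod n"
      using b.pow_mod[of k "\<beta> s" s] k(3) big \<beta>s(2) by simp
    then have 2: "y q mod n = q mod n" using pow_mod_eq[OF big(1) kd] yq k(2) by simp
    have "y q \<le> \<beta> s + d * K" "\<beta> s \<le> y q + d * K"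
      using b.pow_le[where q = "\<beta> s" and k = k] k(3) unfolding yq by linarith+
    then have "\<bar>int (y q) - int q\<bar> \<le> int R" using \<beta>s(3,4) qs unfolding R_def by linarith
    then show ?thesis using 1 2 by simp
  qed
  with y(1,2) show ?thesis by (rule that)
qed

theorem bounded_conjugator:
  obtains x' where "bij x'" "\<And>q. x' (A q) = B (x' q)"
    "\<And>q. q \<ge> M + S + R \<Longrightarrow>
       x' (q + n) = x' q + n \<and> x' q mod n = q mod n \<and> \<bar>int (x' q) - int q\<bar> \<le> int (M + S + R)"
proof -
  obtain x1 where x1: "bij x1" "\<And>q. x1 (A q) = B (x1 q)"
    "\<And>q. q \<ge> M + S \<Longrightarrow> a.drift (q mod n) \<noteq> 0 \<Longrightarrow>
       x1 (q + n) = x1 q + n \<and> x1 q mod n = q mod n \<and> \<bar>int (x1 q) - int q\<bar> \<le> int S"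
    using unwind by blast
  \<comment> \<open>The positive periods that occur far out. Each such period class is replaced as a
    whole, with its points near the centre, because \<open>tail_bijection\<close> rematches those
    too; all other points keep \<open>x1\<close>. Every piece preserves periods, so the pieces fit
    together.\<close>
  define \<Lambda> where "\<Lambda> = {l. l > 0 \<and> (\<exists>q\<ge>M. period A q = l)}"
  have "\<forall>l. \<exists>y. l \<in> \<Lambda> \<longrightarrow> bij_betw y {q. period A q = l} {q. period B q = l}
      \<and> (\<forall>q. period A q = l \<longrightarrow> y (A q) = B (y q))
      \<and> (\<forall>q. period A q = l \<and> q \<ge> R \<longrightarrow>
           y (q + n) = y q + n \<and> y q mod n = q mod n \<and> \<bar>int (y q) - int q\<bar> \<le> int R)"
  proof
    fix l
    show "\<exists>y. l \<in> \<Lambda> \<longrightarrow> bij_betw y {q. period A q = l} {q. period B q = l}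
      \<and> (\<forall>q. period A q = l \<longrightarrow> y (A q) = B (y q))
      \<and> (\<forall>q. period A q = l \<and> q \<ge> R \<longrightarrow>
           y (q + n) = y q + n \<and> y q mod n = q mod n \<and> \<bar>int (y q) - int q\<bar> \<le> int R)"
    proof (cases "l \<in> \<Lambda>")
      case True
      then obtain q0 where q0: "l > 0" "q0 \<ge> M" "period A q0 = l" unfolding \<Lambda>_def by blast
      show ?thesis by (rule rebuild_static[OF q0]) blast
    qed simp
  qed
  from choice[OF this] obtain y where y: "\<And>l. l \<in> \<Lambda> \<Longrightarrow> bij_betw (y l) {q. period A q = l} {q. period B q = l}"
    "\<And>l q. l \<in> \<Lambda> \<Longrightarrow> period A q = l \<Longrightarrow> y l (A q) = B (y l q)"
    "\<And>l q. l \<in> \<Lambda> \<Longrightarrow> period A q = l \<Longrightarrow> q \<ge> R \<Longrightarrow>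
           y l (q + n) = y l q + n \<and> y l q mod n = q mod n \<and> \<bar>int (y l q) - int q\<bar> \<le> int R"
    by blast
  define x' where "x' q = (if period A q \<in> \<Lambda> then y (period A q) q else x1 q)" for q
  have per_x1: "period B (x1 q) = period A q" for q
    using period_intertwine[of x1 A B q] x1(1,2) by (simp add: bij_is_inj)
  have per_x': "period B (x' q) = period A q" for q
    using y(1)[of "period A q"] per_x1 unfolding x'_def by (auto dest: bij_betwE)
  have "bij x'"
  proof (rule bijI)
    show "inj x'"
    proof (rule injI)
      fix q r assume eq: "x' q = x' r"
      then have per: "period A q = period A r" using per_x' by metis
      show "q = r"
      proof (cases "period A q \<in> \<Lambda>")
        case True
        then show ?thesis using y(1)[OF True] eq per unfolding x'_def bij_betw_def inj_on_def by simp
      next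
        case False
        then show ?thesis using eq per x1(1) unfolding x'_def by (simp add: bij_is_inj inj_eq)
      qed
    qed
    show "surj x'" unfolding surj_def
    proof
      fix r
      show "\<exists>q. r = x' q"
      proof (cases "period B r \<in> \<Lambda>")
        case True
        then obtain q where "period A q = period B r" "r = y (period B r) q"
          using y(1)[OF True] unfolding bij_betw_def by blast
        then show ?thesis using True unfolding x'_def by metis
      next
        case False
        obtain q where q: "r = x1 q" using x1(1) by (metis bij_pointE)
        then show ?thesis using False per_x1 unfolding x'_def by metis
      qed
    qed
  qed
  moreover have "x' (A q) = B (x' q)" for q
    using period_funpow[OF a.bij, of 1 q] x1(2) y(2) unfolding x'_def by simp
  moreover have "x' (q + n) = x' q + n \<and> x' q mod n = q mod n \<and> \<bar>int (x' q) - int q\<bar> \<le> int (M + S + R)"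
    if q: "q \<ge> M + S + R" for q
  proof -
    have per: "period A (q + n) = period A q" using a.period_mod[of "q + n" q] q by simp
    show ?thesis
    proof (cases "a.drift (q mod n) = 0")
      case True
      then have "period A q dvd d" using a.static_period q by simp
      then have "period A q > 0" using a.d_pos by (metis dvd_0_left_iff neq0_conv)
      then have "period A q \<in> \<Lambda>"
        unfolding \<Lambda>_def using q by (auto intro!: exI[of _ q])
      then show ?thesis using y(3)[of "period A q" q] q per unfolding x'_def by auto
    next
      case False
      then have "period A q = 0" using a.moving_period q by simp
      then have "x' q = x1 q" "x' (q + n) = x1 (q + n)" using per unfolding x'_def \<Lambda>_def by simp_all
      then show ?thesis using x1(3)[of q] q False by auto
    qed
  qed
  ultimately show ?thesis by (rule that)
qed

end

section \<open>Houghton groups as groups of quasi-periodic maps\<close>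

definition idx :: "nat \<Rightarrow> nat \<times> nat \<Rightarrow> nat" where
  "idx n p = (snd p - 1) * n + (fst p - 1)"

definition pt :: "nat \<Rightarrow> nat \<Rightarrow> nat \<times> nat" where
  "pt n q = (q mod n + 1, q div n + 1)"

definition nat_map :: "nat \<Rightarrow> (nat \<times> nat \<Rightarrow> nat \<times> nat) \<Rightarrow> nat \<Rightarrow> nat" where
  "nat_map n g q = idx n (g (pt n q))"

lemma pt_in_X: "n > 0 \<Longrightarrow> pt n q \<in> X n"
  unfolding pt_def X_def by (simp add: Suc_le_eq)

lemma idx_pt: "idx n (pt n q) = q"
  unfolding idx_def pt_def by simp

lemma pt_idx: "p \<in> X n \<Longrightarrow> pt n (idx n p) = p"
proof -
  assume "p \<in> X n"
  then obtain i m where "p = (Suc i, Suc m)" "i < n"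
    unfolding X_def by (cases p; cases "fst p"; cases "snd p") auto
  then show ?thesis unfolding idx_def pt_def by simp
qed

text \<open>Being the identity off \<open>X n\<close>, the elements are bijections of the whole
  type, which makes \<open>inv\<close> and composition the group operations.\<close>

lemma SymX_bij: "g \<in> SymX n \<Longrightarrow> bij g"
proof -
  assume g: "g \<in> SymX n"
  have "bij_betw g (X n \<union> - X n) (X n \<union> - X n)"
  proof (rule bij_betw_combine)
    show "bij_betw g (X n) (X n)" using g unfolding SymX_def by blast
    have "bij_betw g (- X n) (- X n) \<longleftrightarrow> bij_betw id (- X n) (- X n)"
      by (rule bij_betw_cong) (use g in \<open>auto simp: SymX_def\<close>)
    then show "bij_betw g (- X n) (- X n)" by simp
  qed auto
  then show "bij g" by simp
qed

lemma SymX_in_X: "g \<in> SymX n \<Longrightarrow> p \<in> X n \<Longrightarrow> g p \<in> X n"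
  unfolding SymX_def by (auto dest: bij_betwE)

lemma SymX_id: "id \<in> SymX n"
  unfolding SymX_def by simp

lemma SymX_comp: "g \<in> SymX n \<Longrightarrow> h \<in> SymX n \<Longrightarrow> g \<circ> h \<in> SymX n"
  unfolding SymX_def by (auto intro: bij_betw_trans)

lemma SymX_inv:
  assumes g: "g \<in> SymX n" shows "inv g \<in> SymX n"
proof -
  have b: "bij g" by (rule SymX_bij[OF g])
  have im: "g ` X n = X n" using g unfolding SymX_def bij_betw_def by blast
  have "inv g ` X n = X n"
    using image_inv_f_f[OF bij_is_inj[OF b], of "X n"] unfolding im .
  moreover have "inj_on (inv g) (X n)" using bij_imp_bij_inv[OF b] by (meson bij_is_inj inj_on_subset subset_UNIV)
  moreover have "inv g p = p" if "p \<notin> X n" for p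
  proof -
    have "g p = p" using g that unfolding SymX_def by blast
    then show ?thesis using b by (metis bij_inv_eq_iff)
  qed
  ultimately show ?thesis unfolding SymX_def bij_betw_def by blast
qed

lemma pt_nat_map: "n > 0 \<Longrightarrow> g \<in> SymX n \<Longrightarrow> pt n (nat_map n g q) = g (pt n q)"
  unfolding nat_map_def by (rule pt_idx[OF SymX_in_X[OF _ pt_in_X]])

lemma nat_map_comp: "n > 0 \<Longrightarrow> h \<in> SymX n \<Longrightarrow> nat_map n (g \<circ> h) = nat_map n g \<circ> nat_map n h"
  using pt_nat_map[of n h] by (auto simp: nat_map_def)

lemma nat_map_id: "nat_map n id = id"
  unfolding nat_map_def by (auto simp: idx_pt)

lemma nat_map_inv:
  assumes "n > 0" "g \<in> SymX n" shows "bij (nat_map n g)" "nat_map n (inv g) = inv (nat_map n g)"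
proof -
  have "g \<circ> inv g = id" "inv g \<circ> g = id"
    using SymX_bij[OF assms(2)] by (auto simp: bij_is_surj surj_f_inv_f bij_is_inj fun_eq_iff)
  then have "nat_map n g \<circ> nat_map n (inv g) = id" "nat_map n (inv g) \<circ> nat_map n g = id"
    using nat_map_comp[OF assms(1) SymX_inv[OF assms(2)], of g] nat_map_comp[OF assms, of "inv g"]
    by (simp_all add: nat_map_id)
  then show "bij (nat_map n g)" "nat_map n (inv g) = inv (nat_map n g)"
    by (auto intro: o_bij inv_unique_comp[symmetric])
qed

lemma nat_map_eqD:
  assumes "n > 0" "g \<in> SymX n" "h \<in> SymX n" "nat_map n g = nat_map n h" shows "g = h"
proof
  fix p
  show "g p = h p"
  proof (cases "p \<in> X n")
    case True
    then show ?thesis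
      using pt_nat_map[OF assms(1,2), of "idx n p"] pt_nat_map[OF assms(1,3), of "idx n p"] assms(4)
      by (simp add: pt_idx)
  next
    case False
    then have "g p = p" "h p = p" using assms(2,3) unfolding SymX_def by blast+
    then show ?thesis by simp
  qed
qed

lemma quasi_periodicI:
  assumes n: "n > 0" and b: "bij g" and sh: "\<And>q. q \<ge> Z \<Longrightarrow> g (q + n) = g q + n"
  shows "\<exists>K. quasi_periodic n K g"
proof -
  \<comment> \<open>A crude bound: the sum dominates \<open>g q + q\<close> on the first
    \<open>Z + n\<close> points, and among these every residue has a point not below
    \<open>Z\<close>.\<close>
  define K where "K = Z + n + (\<Sum>q<Z + n. g q + q)"
  have small: "g q + q \<le> K" if "q < Z + n" for q
    using member_le_sum[of q "{..<Z + n}" "\<lambda>q. g q + q"] that unfolding K_def by simp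
  have "g q \<le> q + K \<and> q \<le> g q + K" for q
  proof (cases "q < Z")
    case True
    then show ?thesis using small[of q] by simp
  next
    case False
    define r where "r = Z + (q - Z) mod n"
    have r: "r < Z + n" "r \<ge> Z" unfolding r_def using n by simp_all
    have "q = r + n * ((q - Z) div n)" using False unfolding r_def by simp
    then have "q mod n = r mod n" by (metis mod_mult_self2)
    then have "int (g q) - int q = int (g r) - int r"
      using shift_displacement[of Z g n q r] sh r(2) False by (meson not_less)
    then show ?thesis using small[OF r(1)] by linarith
  qed
  moreover have "g (q + n) = g q + n" if "q \<ge> K" for q using sh that unfolding K_def by simp
  ultimately show ?thesis using b unfolding quasi_periodic_def by blast
qed

definition eventual_translation :: "nat \<Rightarrow> (nat \<Rightarrow> nat) \<Rightarrow> bool" where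
  "eventual_translation n x \<longleftrightarrow> bij x \<and> (\<exists>Z. \<forall>q\<ge>Z. x (q + n) = x q + n \<and> x q mod n = q mod n)"

lemma houghton_eventual_translation:
  assumes n: "n > 0" and g: "g \<in> houghton n" shows "eventual_translation n (nat_map n g)"
proof -
  obtain z :: "nat \<Rightarrow> nat" and t :: "nat \<Rightarrow> int" where gS: "g \<in> SymX n" and
    zt: "\<And>i m. 1 \<le> i \<Longrightarrow> i \<le> n \<Longrightarrow> z i \<le> m \<Longrightarrow> g (i, m) = (i, nat (int m + t i))"
    using g unfolding houghton_def by blast
  define Z where "Z = n * (\<Sum>i\<le>n. z i)"
  have far: "nat_map n g q = nat (int (q div n) + t (q mod n + 1)) * n + q mod n
      \<and> int (q div n) + t (q mod n + 1) \<ge> 0" if q: "q \<ge> Z" for q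
  proof -
    let ?i = "q mod n + 1"
    have i: "1 \<le> ?i" "?i \<le> n" using n by (simp_all add: Suc_le_eq)
    have "z ?i \<le> (\<Sum>i\<le>n. z i)" using i(2) by (intro member_le_sum) auto
    also have "\<dots> \<le> q div n" using q n unfolding Z_def by (simp add: less_eq_div_iff_mult_less_eq mult.commute)
    finally have gq: "g (pt n q) = (?i, nat (int (q div n + 1) + t ?i))"
      unfolding pt_def using zt[OF i] by simp
    \<comment> \<open>The image lies in \<open>X n\<close>, so its height is at least 1; this is
      what keeps \<open>nat\<close> from truncating.\<close>
    then have "(?i, nat (int (q div n + 1) + t ?i)) \<in> X n" using SymX_in_X[OF gS pt_in_X[OF n]] by metis
    then have "nat (int (q div n + 1) + t ?i) \<ge> 1" unfolding X_def by simp
    then have "int (q div n + 1) + t ?i \<ge> 1" by linarith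
    moreover then have "nat (int (q div n + 1) + t ?i) = nat (int (q div n) + t ?i) + 1" by linarith
    ultimately show ?thesis using gq unfolding nat_map_def idx_def by simp
  qed
  have "nat_map n g (q + n) = nat_map n g q + n \<and> nat_map n g q mod n = q mod n" if q: "q \<ge> Z" for q
  proof -
    have "(q + n) div n = q div n + 1" "(q + n) mod n = q mod n" using n div_add_self2[of n q] by simp_all
    moreover have "nat (int (q div n + 1) + t (q mod n + 1)) = nat (int (q div n) + t (q mod n + 1)) + 1"
      using conjunct2[OF far[OF q]] by linarith
    ultimately show ?thesis using far[OF q] far[of "q + n"] q by simp
  qed
  then show ?thesis unfolding eventual_translation_def using nat_map_inv(1)[OF n gS] by blast
qed

lemma eventual_translation_houghton:
  assumes n: "n > 0" and x: "eventual_translation n x"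
  obtains g where "g \<in> houghton n" "nat_map n g = x"
proof -
  obtain Z where b: "bij x" and sh: "\<And>q. q \<ge> Z \<Longrightarrow> x (q + n) = x q + n"
    and md: "\<And>q. q \<ge> Z \<Longrightarrow> x q mod n = q mod n"
    using x unfolding eventual_translation_def by blast
  define g where "g p = (if p \<in> X n then pt n (x (idx n p)) else p)" for p
  have gS: "g \<in> SymX n"
  proof -
    have "bij_betw g (X n) (X n)"
    proof (rule bij_betw_byWitness[where f' = "\<lambda>p. pt n (inv x (idx n p))"])
      show "\<forall>p\<in>X n. pt n (inv x (idx n (g p))) = p"
        using b by (simp add: g_def idx_pt pt_idx bij_is_inj)
      show "\<forall>p\<in>X n. g (pt n (inv x (idx n p))) = p"
        using b n by (simp add: g_def idx_pt pt_idx pt_in_X bij_is_surj surj_f_inv_f)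
    qed (use n pt_in_X in \<open>auto simp: g_def\<close>)
    then show ?thesis unfolding SymX_def by (simp add: g_def)
  qed
  have ng: "nat_map n g = x" using n by (auto simp: nat_map_def g_def pt_in_X idx_pt)
  \<comment> \<open>The shift of \<open>x\<close> on the residue \<open>i - 1\<close>, which belongs
    to ray \<open>i\<close>. One step along a ray counts \<open>n\<close> in the enumeration, so the
    ray is translated by \<open>c i div int n\<close>.\<close>
  define c where "c i = int (x (i - 1 + n * Z)) - int (i - 1 + n * Z)" for i
  have "g (i, m) = (i, nat (int m + c i div int n))" if i: "1 \<le> i" "i \<le> n" and m: "Z + 1 \<le> m" for i m
  proof -
    define q where "q = idx n (i, m)"
    have q: "q = (m - 1) * n + (i - 1)" unfolding q_def idx_def by simp
    have "m - 1 \<le> (m - 1) * n" using n by simp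
    then have qZ: "q \<ge> Z" using m unfolding q by linarith
    have "i - 1 < n" using i by simp
    then have qm: "q mod n = i - 1" unfolding q by simp
    have "i - 1 + n * Z \<ge> Z" using n by (simp add: trans_le_add2)
    moreover have "q mod n = (i - 1 + n * Z) mod n"
      unfolding qm using \<open>i - 1 < n\<close> by (metis mod_less mod_mult_self2)
    ultimately have xq: "int (x q) = int q + c i"
      using shift_displacement[of Z x n q "i - 1 + n * Z"] sh qZ unfolding c_def by simp
    have "int n dvd c i" using md[OF qZ] xq by (metis add_diff_cancel_left' mod_eq_dvd_iff of_nat_mod)
    then obtain e where e: "c i = int n * e" ..
    have "int (x q div n) = int q div int n + e"
      unfolding of_nat_div xq e using n by simp
    also have "q div n = m - 1" unfolding q using \<open>i - 1 < n\<close> by simp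
    then have "int q div int n = int (m - 1)" by (metis of_nat_div)
    finally have "int (x q div n) = int (m - 1) + e" .
    moreover have "x q mod n = i - 1" using md[OF qZ] qm by simp
    ultimately have "pt n (x q) = (i, nat (int m + e))" unfolding pt_def using i(1) m by simp
    moreover have "(i, m) \<in> X n" using i m unfolding X_def by simp
    ultimately show ?thesis unfolding g_def q_def e using n by simp
  qed
  then have "g \<in> houghton n" unfolding houghton_def using gS
    by (intro CollectI conjI exI[of _ "\<lambda>_. Z + 1"] exI[of _ "\<lambda>i. c i div int n"]) auto
  then show ?thesis using ng by (rule that)
qed

text \<open>An invariant shared by both kinds of generators and stable under products and inverses.
  It does not ask for residues to be preserved, since ray permutations permute them.\<close>

definition admissible :: "nat \<Rightarrow> (nat \<times> nat \<Rightarrow> nat \<times> nat) \<Rightarrow> bool" where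
  "admissible n g \<longleftrightarrow> g \<in> SymX n \<and> (\<exists>K. quasi_periodic n K (nat_map n g))"

lemma admissible_houghton: "n > 0 \<Longrightarrow> g \<in> houghton n \<Longrightarrow> admissible n g"
  using houghton_eventual_translation[of n g] quasi_periodicI[of n "nat_map n g"]
  unfolding admissible_def eventual_translation_def houghton_def by blast

lemma admissible_ray_perm:
  assumes n: "n > 0" and s: "\<sigma> permutes {1..n}" shows "admissible n (ray_perm n \<sigma>)"
proof -
  have in_X: "(\<sigma> i, m) \<in> X n \<longleftrightarrow> (i, m) \<in> X n" for i m
    using permutes_in_image[OF s, of i] unfolding X_def by auto
  have S: "ray_perm n \<sigma> \<in> SymX n"
  proof -
    have "bij_betw (ray_perm n \<sigma>) (X n) (X n)"
    proof (rule bij_betw_byWitness[where f' = "ray_perm n (inv \<sigma>)"])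
      have in_X': "(inv \<sigma> i, m) \<in> X n \<longleftrightarrow> (i, m) \<in> X n" for i m
        using permutes_in_image[OF permutes_inv[OF s], of i] unfolding X_def by auto
      show "\<forall>p\<in>X n. ray_perm n (inv \<sigma>) (ray_perm n \<sigma> p) = p"
        "\<forall>p\<in>X n. ray_perm n \<sigma> (ray_perm n (inv \<sigma>) p) = p"
        using in_X in_X' permutes_inverses[OF s] unfolding ray_perm_def by auto
      show "ray_perm n \<sigma> ` X n \<subseteq> X n" "ray_perm n (inv \<sigma>) ` X n \<subseteq> X n"
        using in_X in_X' unfolding ray_perm_def by auto
    qed
    then show ?thesis unfolding SymX_def ray_perm_def by auto
  qed
  have "nat_map n (ray_perm n \<sigma>) (q + n) = nat_map n (ray_perm n \<sigma>) q + n" for q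
  proof -
    have "(q + n) div n = q div n + 1" using n div_add_self2[of n q] by simp
    then show ?thesis
      using pt_in_X[OF n, of q] pt_in_X[OF n, of "q + n"] n
      unfolding nat_map_def ray_perm_def pt_def idx_def by simp
  qed
  then have "\<exists>K. quasi_periodic n K (nat_map n (ray_perm n \<sigma>))"
    by (intro quasi_periodicI[OF n nat_map_inv(1)[OF n S], of 0])
  then show ?thesis using S unfolding admissible_def by blast
qed

lemma admissible_id: "admissible n id"
  unfolding admissible_def using SymX_id quasi_periodic_id nat_map_id by metis

lemma admissible_comp: "n > 0 \<Longrightarrow> admissible n g \<Longrightarrow> admissible n h \<Longrightarrow> admissible n (g \<circ> h)"
  unfolding admissible_def using SymX_comp quasi_periodic_comp nat_map_comp by metis

lemma admissible_inv: "n > 0 \<Longrightarrow> admissible n g \<Longrightarrow> admissible n (inv g)"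
  unfolding admissible_def using SymX_inv quasi_periodic_inv nat_map_inv(2) by metis

lemma admissible_houghton_ext:
  assumes n: "n > 0" and g: "g \<in> houghton_ext n" shows "admissible n g"
proof -
  have gen: "admissible n h" if "h \<in> houghton n \<union> {ray_perm n \<sigma> | \<sigma>. \<sigma> permutes {1..n}}" for h
    using that admissible_houghton[OF n] admissible_ray_perm[OF n] by blast
  show ?thesis using g unfolding houghton_ext_def
  proof (induction rule: gen_by.induct)
    case gen_id
    show ?case by (rule admissible_id)
  next
    case (gen_mult f g)
    then show ?case using admissible_comp[OF n gen] by blast
  next
    case (gen_mult_inv f g)
    then show ?case using admissible_comp[OF n admissible_inv[OF n gen]] by blast
  qed
qed

text \<open>The values below \<open>K + n\<close> form a finite table built into the function, and
  arithmetic gives the rest. No procedure for finding the table is needed, as the lemma is applied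
  to finitely many fixed letters.\<close>

lemma computable1_quasi_periodic:
  assumes n: "n > 0" and g: "quasi_periodic n K g" shows "computable1 g"
proof -
  have sh: "\<And>q. q \<ge> K \<Longrightarrow> g (q + n) = g q + n" using g unfolding quasi_periodic_def by blast
  define tb where "tb q = (if q < K + n then g q else 0)" for q
  have "computable1 (\<lambda>_. 0)" unfolding computable1_def by (rule computable_const)
  then have tb: "computable1 tb"
    by (rule computable1_finite_change) (rule finite_subset[of _ "{..<K + n}"], auto simp: tb_def)
  define h where "h q = tb (K + (q - K) mod n) + (q - K) div n * n" for q
  have "computable1 h" unfolding computable1_def h_def
    by (intro computable_add computable_mult computable_div computable_mod computable_diff
        computable_const computable_nth computable1_app[OF tb]) simp_all
  moreover have "g q = h q" if "q \<ge> K" for q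
  proof -
    have "q = K + (q - K) mod n + n * ((q - K) div n)" using that by simp
    then have "g q = g (K + (q - K) mod n) + n * ((q - K) div n)"
      using shift_iterate[of K g n "K + (q - K) mod n" "(q - K) div n"] sh by simp
    then show ?thesis unfolding h_def tb_def using n by simp
  qed
  then have "{q. g q \<noteq> h q} \<subseteq> {..<K}" by (auto simp flip: not_le)
  ultimately show ?thesis using computable1_finite_change finite_subset by blast
qed

text \<open>Lets the code of a word stand in for its length, both as a number of simulation steps
  and as a factor in the displacement bound.\<close>

lemma length_le_list_encode: "length w \<le> list_encode w"
proof (induction w)
  case (Cons a w)
  then show ?case using le_prod_encode_2[of "list_encode w" a] by simp
qed simp

lemma word_evaluation:
  assumes n: "n > 0" and gs: "\<And>g. g \<in> set gs \<Longrightarrow> admissible n g"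
  obtains c F where "computable2 F"
    "\<And>w. valid_word gs w \<Longrightarrow> eval_word gs w \<in> SymX n
       \<and> quasi_periodic n (c * list_encode w) (nat_map n (eval_word gs w))
       \<and> F (list_encode w) = nat_map n (eval_word gs w)"
proof -
  have adm: "admissible n (letter gs k)" if "k < 2 * length gs" for k
    using gs[of "gs ! (k div 2)"] admissible_inv[OF n] that unfolding letter_def by auto
  then have "\<forall>k. \<exists>K. k < 2 * length gs \<longrightarrow> quasi_periodic n K (nat_map n (letter gs k))"
    unfolding admissible_def by blast
  from choice[OF this] obtain kk where
    kk: "\<And>k. k < 2 * length gs \<Longrightarrow> quasi_periodic n (kk k) (nat_map n (letter gs k))" by blast
  define c where "c = (\<Sum>k<2 * length gs. kk k)"
  have c: "quasi_periodic n c (nat_map n (letter gs k))" if "k < 2 * length gs" for k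
    using quasi_periodic_mono[OF kk[OF that]] member_le_sum[of k "{..<2 * length gs}" kk] that
    unfolding c_def by simp
  obtain act where act: "computable2 act"
    "\<And>k q. k < 2 * length gs \<Longrightarrow> act k q = nat_map n (letter gs k) q"
    using computable2_finite_cases[of "2 * length gs" "\<lambda>k. nat_map n (letter gs k)"]
      computable1_quasi_periodic[OF n c] by blast
  \<comment> \<open>A state pairs the code of the unread word with the current point. The code of a
    nonempty list is the successor of a pair code, hence the predecessor before decoding. Code 0,
    the empty word, makes the state stationary, so surplus steps do no harm.\<close>
  define step where "step u = (if fst (prod_decode u) = 0 then u else
     prod_encode (snd (prod_decode (fst (prod_decode u) - 1)),
       act (fst (prod_decode (fst (prod_decode u) - 1))) (snd (prod_decode u))))" for u
  define F where "F w q = snd (prod_decode (rec_nat (prod_encode (w, q)) (\<lambda>_ u. step u) w))" for w q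
  have "computable2 F" unfolding computable2_def F_def
  proof (rule computable_snd_decode, rule computable_rec)
    show "computable (2 + 2) (\<lambda>ys. step (ys ! 1))" unfolding step_def
      by (intro computable_intros computable2_app[OF act(1)]) simp_all
  qed (intro computable_intros; simp)+
  moreover have "eval_word gs w \<in> SymX n
       \<and> quasi_periodic n (c * length w) (nat_map n (eval_word gs w))
       \<and> (\<forall>m q. length w \<le> m \<longrightarrow> (step ^^ m) (prod_encode (list_encode w, q)) = prod_encode (0, nat_map n (eval_word gs w) q))"
    if "valid_word gs w" for w
    using that
  proof (induction w)
    case Nil
    have "(step ^^ m) (prod_encode (0, q)) = prod_encode (0, id q)" for m q
      by (induction m) (simp_all add: step_def)
    moreover have "eval_word gs [] = id" by (rule eval_word.simps)
    ultimately show ?case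
      unfolding \<open>eval_word gs [] = id\<close> nat_map_id list_encode.simps
      using SymX_id quasi_periodic_id by blast
  next
    case (Cons k w)
    then have k: "k < 2 * length gs" and w: "valid_word gs w" unfolding valid_word_def by auto
    have lS: "letter gs k \<in> SymX n" using adm[OF k] unfolding admissible_def by blast
    have nm: "nat_map n (eval_word gs w \<circ> letter gs k) = nat_map n (eval_word gs w) \<circ> nat_map n (letter gs k)"
      by (rule nat_map_comp[OF n lS])
    have "(step ^^ m) (prod_encode (list_encode (k # w), q)) = prod_encode (0, nat_map n (eval_word gs (k # w)) q)"
      if m: "length (k # w) \<le> m" for m q
    proof -
      obtain m' where m': "m = Suc m'" "length w \<le> m'" using m by (cases m) auto
      have "step (prod_encode (list_encode (k # w), q)) = prod_encode (list_encode w, nat_map n (letter gs k) q)"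
        unfolding step_def by (simp add: act(2)[OF k])
      then have "(step ^^ m) (prod_encode (list_encode (k # w), q))
         = (step ^^ m') (prod_encode (list_encode w, nat_map n (letter gs k) q))"
        unfolding m' funpow_Suc_right by simp
      also have "\<dots> = prod_encode (0, nat_map n (eval_word gs w) (nat_map n (letter gs k) q))"
        using Cons.IH[OF w] m'(2) by blast
      finally show ?thesis using nm by simp
    qed
    moreover have "quasi_periodic n (c * length (k # w)) (nat_map n (eval_word gs (k # w)))"
      using quasi_periodic_comp[of n "c * length w" _ c] Cons.IH[OF w] c[OF k] nm by (simp add: add.commute)
    moreover have "eval_word gs (k # w) \<in> SymX n" using SymX_comp lS Cons.IH[OF w] by simp
    ultimately show ?case by blast
  qed
  moreover have "rec_nat u (\<lambda>_. step) m = (step ^^ m) u" for u m by (induction m) auto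
  ultimately have "eval_word gs w \<in> SymX n
       \<and> quasi_periodic n (c * list_encode w) (nat_map n (eval_word gs w))
       \<and> F (list_encode w) = nat_map n (eval_word gs w)" if "valid_word gs w" for w
    using that length_le_list_encode[of w] quasi_periodic_mono[of n "c * length w" _ "c * list_encode w"]
    unfolding F_def by auto
  with \<open>computable2 F\<close> show ?thesis by (rule that)
qed

section \<open>The search over tables\<close>

text \<open>The bound \<open>M + S + R\<close> of \<open>conjugate_pair\<close> written out, so that
  for fixed \<open>n\<close> it is visibly a recursive function of \<open>K\<close>.\<close>

definition width :: "nat \<Rightarrow> nat \<Rightarrow> nat" where
  "width n K = (let d = fact n; M = d * K + K in
     M + (d * K + 2 * (M + 5 * (d * K)) * n^2 * (d * K)) + (n * M + n * (n * M) + n + 2 * (d * K)))"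

lemma width_bound:
  assumes "n > 0" and A: "quasi_periodic n K A" and B: "quasi_periodic n K B"
    and x: "eventual_translation n x" "\<And>q. x (A q) = B (x q)"
  obtains x' where "bij x'" "\<And>q. x' (A q) = B (x' q)"
    "\<And>q. q \<ge> width n K \<Longrightarrow>
       x' (q + n) = x' q + n \<and> x' q mod n = q mod n \<and> \<bar>int (x' q) - int q\<bar> \<le> int (width n K)"
proof -
  obtain Z where Z: "\<And>q. q \<ge> Z \<Longrightarrow> x (q + n) = x q + n \<and> x q mod n = q mod n"
    using x(1) unfolding eventual_translation_def by blast
  interpret conjugate_pair n "fact n" K A B x Z
    by unfold_locales (use assms Z in \<open>auto simp: eventual_translation_def\<close>)
  have w: "width n K = M + S + R"
    unfolding width_def Let_def a.M_def S_def R_def ..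
  show ?thesis unfolding w by (rule bounded_conjugator) (rule that[unfolded w]; assumption)
qed

text \<open>A map that commutes with the shift by \<open>n\<close> from \<open>W\<close> on is determined by its first
  \<open>W + n\<close> values, stored as the base \<open>b\<close> digits of \<open>y\<close>.\<close>

definition table_map :: "nat \<Rightarrow> nat \<Rightarrow> nat \<Rightarrow> nat \<Rightarrow> nat \<Rightarrow> nat" where
  "table_map n W b y q = (if q < W then y div b ^ q mod b
     else y div b ^ (W + (q - W) mod n) mod b + (q - W) div n * n)"

lemma digits:
  fixes f :: "nat \<Rightarrow> nat"
  assumes "\<And>q. q < N \<Longrightarrow> f q < b"
  shows "\<exists>y<b ^ N. \<forall>q<N. y div b ^ q mod b = f q"
  using assms
proof (induction N)
  case (Suc N)
  then obtain y where y: "y < b ^ N" "\<forall>q<N. y div b ^ q mod b = f q" by auto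
  have fN: "f N < b" using Suc.prems by simp
  let ?y = "y + f N * b ^ N"
  have "?y < (f N + 1) * b ^ N" using y(1) by simp
  also have "\<dots> \<le> b * b ^ N" using fN by (intro mult_le_mono1) simp
  finally have "?y < b ^ Suc N" by simp
  moreover have "?y div b ^ q mod b = f q" if q: "q < Suc N" for q
  proof (cases "q = N")
    case True
    then show ?thesis using y(1) fN by simp
  next
    case False
    then have qN: "q < N" using q by simp
    then obtain m where m: "N = q + Suc m" using less_iff_Suc_add[of q N] by auto
    have b: "b ^ q > 0" using fN by simp
    have "?y = y + f N * b ^ m * b * b ^ q" unfolding m power_add by simp
    then have "?y div b ^ q = y div b ^ q + f N * b ^ m * b"
      using b div_mult_self1[of "b ^ q" y "f N * b ^ m * b"] by (simp only:)
    then show ?thesis using y(2) qN by simp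
  qed
  ultimately show ?case by blast
qed simp

text \<open>All quantifiers are bounded, so this is a recursive test. One period suffices for the
  residues, and \<open>V\<close> limits the search for preimages of points below
  \<open>U\<close>.\<close>

definition table_conjugates :: "nat \<Rightarrow> nat \<Rightarrow> nat \<Rightarrow> nat \<Rightarrow> nat \<Rightarrow> (nat \<Rightarrow> nat) \<Rightarrow> (nat \<Rightarrow> nat) \<Rightarrow> nat \<Rightarrow> bool" where
  "table_conjugates n W b U V A B y \<longleftrightarrow>
     (\<forall>q<W + n. W \<le> q \<longrightarrow> table_map n W b y q mod n = q mod n) \<and>
     (\<forall>q<U. table_map n W b y (A q) = B (table_map n W b y q)) \<and>
     (\<forall>q<U. \<forall>r<U. table_map n W b y q = table_map n W b y r \<longrightarrow> q = r) \<and>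
     (\<forall>r<U. \<exists>q<V. table_map n W b y q = r)"

lemma table_map_shift: "n > 0 \<Longrightarrow> q \<ge> W \<Longrightarrow> table_map n W b y (q + n) = table_map n W b y q + n"
proof -
  assume n: "n > 0" and q: "q \<ge> W"
  then have "q + n - W = (q - W) + n" by linarith
  have "(q + n - W) mod n = (q - W) mod n" "(q + n - W) div n = (q - W) div n + 1"
    unfolding \<open>q + n - W = (q - W) + n\<close> using n div_add_self2[of n "q - W"] by simp_all
  then show ?thesis using q unfolding table_map_def by simp
qed

text \<open>Periodicity extends the finite checks beyond \<open>U\<close>. Digits are smaller than
  \<open>b\<close>, and from \<open>U\<close> on the table map takes values not below
  \<open>b\<close>; so no value on the first \<open>W\<close> points is taken again there, and a
  preimage of a point not below \<open>b\<close> lies where the table map commutes with the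
  shift.\<close>

lemma table_conjugates_sound:
  assumes n: "n > 0" and A: "quasi_periodic n K A" and B: "quasi_periodic n K B"
    and b: "b > 0" and U: "U \<ge> b + W + 2 * n + K" and ok: "table_conjugates n W b U V A B y"
  shows "eventual_translation n (table_map n W b y)"
    and "table_map n W b y (A q) = B (table_map n W b y q)"
proof -
  let ?x = "table_map n W b y"
  have sh: "\<And>q. q \<ge> W \<Longrightarrow> ?x (q + n) = ?x q + n" using table_map_shift[OF n] .
  have low: "?x q < b" if "q < W" for q using b that unfolding table_map_def by simp
  have red: "W + (q - W) mod n \<ge> W \<and> W + (q - W) mod n < W + n
     \<and> q = W + (q - W) mod n + n * ((q - W) div n)" if "q \<ge> W" for q using that n by simp
  have red_x: "?x q = ?x (W + (q - W) mod n) + n * ((q - W) div n)" if "q \<ge> W" for q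
    using shift_iterate[of W ?x n "W + (q - W) mod n" "(q - W) div n", OF sh] red[OF that] by simp
  have high: "q \<le> ?x q + W + n" if "q \<ge> W" for q using red[OF that] red_x[OF that] by linarith
  have md: "?x q mod n = q mod n" if q: "q \<ge> W" for q
  proof -
    have "?x q mod n = ?x (W + (q - W) mod n) mod n" using red_x[OF q] by (metis mod_mult_self2)
    also have "\<dots> = (W + (q - W) mod n) mod n"
      using ok red[OF q] unfolding table_conjugates_def by blast
    also have "\<dots> = q mod n" using red[OF q] by (metis mod_mult_self2)
    finally show ?thesis .
  qed
  have eqv: "?x (A q) = B (?x q)" for q
  proof (induction q rule: less_induct)
    case (less q)
    show ?case
    proof (cases "q < U")
      case True
      then show ?thesis using ok unfolding table_conjugates_def by blast
    next
      case False
      \<comment> \<open>Since \<open>p \<ge> W + n + K\<close>, the point \<open>A p\<close> is not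
        below \<open>W\<close> and \<open>?x p\<close> is not below \<open>K\<close>, so the shift
        by \<open>n\<close> passes through \<open>A\<close>, \<open>B\<close> and the table
        map.\<close>
      define p where "p = q - n"
      have p: "q = p + n" "p < q" "p \<ge> W + n + K" using False U n unfolding p_def by simp_all
      have "A p \<ge> W" using A p(3) unfolding quasi_periodic_def by (metis add.commute add_le_cancel_left le_add1 le_trans add.assoc)
      then have "?x (A q) = ?x (A p) + n"
        using sh A p unfolding quasi_periodic_def by simp
      also have "\<dots> = B (?x p) + n" using less.IH[OF p(2)] by simp
      also have "\<dots> = B (?x p + n)"
        using B high[of p] p(3) unfolding quasi_periodic_def by simp
      also have "\<dots> = B (?x q)" using sh[of p] p by simp
      finally show ?thesis .
    qed
  qed
  then show "?x (A q) = B (?x q)" .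
  have inj_le: "q = r" if eq: "?x q = ?x r" and le: "q \<le> r" for q r
  proof -
    consider "r < U" | "r \<ge> U" "q < W" | "q \<ge> W" by linarith
    then show ?thesis
    proof cases
      case 1
      then show ?thesis using ok eq le unfolding table_conjugates_def by auto
    next
      case 2
      then show ?thesis using low[of q] high[of r] eq U by simp
    next
      case 3
      then have "r mod n = q mod n" using md[of q] md[of r] le eq by simp
      then obtain j where j: "r = q + n * j" using le by (metis mod_eq_nat2E)
      then have "?x r = ?x q + n * j" using shift_iterate[of W ?x n q j, OF sh 3] by simp
      then show ?thesis using eq j by simp
    qed
  qed
  have "bij ?x"
  proof (rule bijI)
    show "inj ?x" using inj_le by (intro injI) (metis nat_le_linear)
    have "\<exists>q. ?x q = r" for r
    proof (induction r rule: less_induct)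
      case (less r)
      show ?case
      proof (cases "r < U")
        case True
        then show ?thesis using ok unfolding table_conjugates_def by blast
      next
        case False
        then have r: "r - n < r" "r = r - n + n" "r - n \<ge> b" using U n by simp_all
        obtain q where q: "?x q = r - n" using less.IH[OF r(1)] by blast
        then have "q \<ge> W" using low[of q] r(3) by linarith
        then have "?x (q + n) = r" using sh q r(2) by simp
        then show ?thesis ..
      qed
    qed
    then show "surj ?x" unfolding surj_def by metis
  qed
  then show "eventual_translation n ?x"
    unfolding eventual_translation_def using sh md by blast
qed

lemma conjugate_iff_table:
  assumes n: "n > 0" and A: "quasi_periodic n K A" and B: "quasi_periodic n K B"
    and W: "W = width n K" and b: "b = 2 * W + n" and U: "U = b + W + 2 * n + K" and V: "V = U + W + n"
  shows "(\<exists>x. eventual_translation n x \<and> (\<forall>q. x (A q) = B (x q)))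
    \<longleftrightarrow> (\<exists>y<b ^ (W + n). table_conjugates n W b U V A B y)"
proof
  assume "\<exists>x. eventual_translation n x \<and> (\<forall>q. x (A q) = B (x q))"
  then obtain x0 where x0: "eventual_translation n x0" "\<And>q. x0 (A q) = B (x0 q)" by blast
  obtain x where x: "bij x" "\<And>q. x (A q) = B (x q)"
    and far: "\<And>q. q \<ge> W \<Longrightarrow> x (q + n) = x q + n \<and> x q mod n = q mod n \<and> \<bar>int (x q) - int q\<bar> \<le> int W"
    unfolding W by (rule width_bound[OF n A B x0]) (rule that[unfolded W]; assumption)
  have sh: "\<And>q. q \<ge> W \<Longrightarrow> x (q + n) = x q + n" using far by blast
  have xinj: "x q = x r \<Longrightarrow> q = r" for q r using x(1) by (meson bij_is_inj injD)
  have xb: "x q < b" if q: "q < W + n" for q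
  proof (cases "q < W")
    case False
    then show ?thesis using far[of q] q b by linarith
  next
    case True
    show ?thesis
    proof (rule ccontr)
      \<comment> \<open>So large a value \<open>r\<close> is also taken at some
        \<open>r' \<ge> W\<close>, found by going back from \<open>r\<close> by the displacement of
        \<open>x\<close> on its residue class, which is at most \<open>W\<close>. Injectivity then
        contradicts \<open>q < W\<close>.\<close>
      assume big: "\<not> x q < b"
      define r where "r = x q"
      have r: "r \<ge> 2 * W + n" using big b unfolding r_def by simp
      define p where "p = W + (r - W) mod n"
      have p: "p \<ge> W" "p < W + n" "r = p + n * ((r - W) div n)" using r n unfolding p_def by simp_all
      have xr: "x r = x p + n * ((r - W) div n)" using shift_iterate[of W x n p "(r - W) div n", OF sh p(1)] p(3) by simp
      then have xr_disp: "int (x r) - int r = int (x p) - int p" using p(3) by linarith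
      define r' where "r' = nat (int r - (int (x p) - int p))"
      have xp: "\<bar>int (x p) - int p\<bar> \<le> int W" using far[OF p(1)] by blast
      then have r': "int r' = int r - (int (x p) - int p)" "r' \<ge> W" using r unfolding r'_def by linarith+
      have "int n dvd int (x p) - int p" using far[OF p(1)] by (metis mod_eq_dvd_iff of_nat_mod)
      then have "int n dvd int r' - int r" unfolding r'(1) by (simp add: dvd_diff_commute)
      then have "r' mod n = r mod n" by (metis mod_eq_dvd_iff of_nat_eq_iff of_nat_mod)
      moreover have "r mod n = p mod n" using p(3) by (metis mod_mult_self2)
      ultimately have "int (x r') - int r' = int (x p) - int p"
        using shift_displacement[of W x n r' p, OF sh r'(2) p(1)] by simp
      then have "x r' = x q" using r'(1) unfolding r_def by linarith
      then show False using xinj r'(2) True by fastforce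
    qed
  qed
  obtain y where y: "y < b ^ (W + n)" "\<And>q. q < W + n \<Longrightarrow> y div b ^ q mod b = x q"
    using digits[of "W + n" x b] xb by blast
  have tx: "table_map n W b y = x"
  proof
    fix q
    show "table_map n W b y q = x q"
    proof (cases "q < W")
      case True
      then show ?thesis unfolding table_map_def using y(2) by simp
    next
      case False
      define p where "p = W + (q - W) mod n"
      have p: "p \<ge> W" "p < W + n" "q = p + n * ((q - W) div n)" using False n unfolding p_def by simp_all
      have "x q = x p + n * ((q - W) div n)"
        using shift_iterate[of W x n p "(q - W) div n", OF sh p(1)] p(3) by simp
      then show ?thesis unfolding table_map_def p_def[symmetric] using False y(2)[OF p(2)] by simp
    qed
  qed
  have "table_conjugates n W b U V A B y"
    unfolding table_conjugates_def tx
  proof (intro conjI allI impI)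
    fix r assume r: "r < U"
    obtain q where q: "x q = r" using x(1) by (metis bij_pointE)
    have "q < V"
    proof (cases "q < W")
      case False
      then show ?thesis using far[of q] q r V by linarith
    qed (use V in simp)
    then show "\<exists>q<V. x q = r" using q by blast
  qed (use far x(2) xinj in auto)
  then show "\<exists>y<b ^ (W + n). table_conjugates n W b U V A B y" using y(1) by blast
next
  assume "\<exists>y<b ^ (W + n). table_conjugates n W b U V A B y"
  then obtain y where y: "table_conjugates n W b U V A B y" by blast
  have "b > 0" using b n by simp
  then show "\<exists>x. eventual_translation n x \<and> (\<forall>q. x (A q) = B (x q))"
    using table_conjugates_sound[OF n A B _ _ y] U by blast
qed

lemma twisted_conj_iff:
  assumes n: "n > 0" and S: "\<rho> \<in> SymX n" "a \<in> SymX n" "b \<in> SymX n"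
  shows "twisted_conj n \<rho> a b \<longleftrightarrow> (\<exists>x. eventual_translation n x \<and>
    (\<forall>q. x (nat_map n a (nat_map n \<rho> q)) = nat_map n b (nat_map n \<rho> (x q))))"
proof -
  have eq: "x \<circ> a \<circ> \<rho> \<circ> inv x \<circ> inv \<rho> = b \<longleftrightarrow>
      (\<forall>q. nat_map n x (nat_map n a (nat_map n \<rho> q)) = nat_map n b (nat_map n \<rho> (nat_map n x q)))"
    if x: "x \<in> houghton n" for x
  proof -
    have xS: "x \<in> SymX n" using x unfolding houghton_def by blast
    have bx: "bij x" "bij \<rho>" using SymX_bij xS S(1) by blast+
    have "x \<circ> a \<circ> \<rho> \<circ> inv x \<circ> inv \<rho> = b \<longleftrightarrow> x \<circ> (a \<circ> \<rho>) = (b \<circ> \<rho>) \<circ> x"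
    proof
      assume e: "x \<circ> a \<circ> \<rho> \<circ> inv x \<circ> inv \<rho> = b"
      show "x \<circ> (a \<circ> \<rho>) = (b \<circ> \<rho>) \<circ> x"
        unfolding e[symmetric] using bx by (simp add: fun_eq_iff bij_is_inj)
    next
      assume e: "x \<circ> (a \<circ> \<rho>) = (b \<circ> \<rho>) \<circ> x"
      show "x \<circ> a \<circ> \<rho> \<circ> inv x \<circ> inv \<rho> = b"
      proof
        fix p
        have "(x \<circ> (a \<circ> \<rho>)) (inv x (inv \<rho> p)) = ((b \<circ> \<rho>) \<circ> x) (inv x (inv \<rho> p))" unfolding e ..
        then show "(x \<circ> a \<circ> \<rho> \<circ> inv x \<circ> inv \<rho>) p = b p"
          using bx by (simp add: bij_is_surj surj_f_inv_f)
      qed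
    qed
    also have "\<dots> \<longleftrightarrow> nat_map n (x \<circ> (a \<circ> \<rho>)) = nat_map n ((b \<circ> \<rho>) \<circ> x)"
      using nat_map_eqD[OF n] SymX_comp xS S by metis
    also have "\<dots> \<longleftrightarrow> (\<forall>q. nat_map n x (nat_map n a (nat_map n \<rho> q)) = nat_map n b (nat_map n \<rho> (nat_map n x q)))"
      using nat_map_comp[OF n SymX_comp[OF S(2,1)], of x] nat_map_comp[OF n S(1), of a]
        nat_map_comp[OF n xS, of "b \<circ> \<rho>"] nat_map_comp[OF n S(1), of b]
      by (simp add: fun_eq_iff)
    finally show ?thesis .
  qed
  show ?thesis
  proof
    assume "twisted_conj n \<rho> a b"
    then obtain x where x: "x \<in> houghton n" "x \<circ> a \<circ> \<rho> \<circ> inv x \<circ> inv \<rho> = b"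
      unfolding twisted_conj_def by blast
    then show "\<exists>x. eventual_translation n x \<and>
      (\<forall>q. x (nat_map n a (nat_map n \<rho> q)) = nat_map n b (nat_map n \<rho> (x q)))"
      using eq[OF x(1)] houghton_eventual_translation[OF n x(1)] by blast
  next
    assume "\<exists>x. eventual_translation n x \<and>
      (\<forall>q. x (nat_map n a (nat_map n \<rho> q)) = nat_map n b (nat_map n \<rho> (x q)))"
    then obtain x where x: "eventual_translation n x"
      "\<forall>q. x (nat_map n a (nat_map n \<rho> q)) = nat_map n b (nat_map n \<rho> (x q))" by blast
    obtain g where "g \<in> houghton n" "nat_map n g = x" using eventual_translation_houghton[OF n x(1)] .
    then show "twisted_conj n \<rho> a b" unfolding twisted_conj_def using eq x(2) by blast
  qed
qed

section \<open>Computability of the search and the decision procedure\<close>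

lemma computable_width: "computable k a \<Longrightarrow> computable k (\<lambda>xs. width n (a xs))"
  unfolding width_def Let_def by (intro computable_add computable_mult computable_const)

lemma computable_table_map:
  assumes "computable k W" "computable k b" "computable k y" "computable k q"
  shows "computable k (\<lambda>xs. table_map n (W xs) (b xs) (y xs) (q xs))"
  unfolding table_map_def
  by (intro computable_if decidable_less computable_mod computable_div computable_power computable_add
      computable_mult computable_diff computable_const assms)

lemma decidable_table_search:
  assumes F: "computable2 F" and G: "computable2 G"
    and N: "computable 3 N" and W: "computable 3 W" and b: "computable 3 b" and U: "computable 3 U" and V: "computable 3 V"
  shows "decidable 3 (\<lambda>xs. \<exists>y<N xs. table_conjugates n (W xs) (b xs) (U xs) (V xs)
    (\<lambda>q. F (xs ! 1) (G (xs ! 0) q)) (\<lambda>q. F (xs ! 2) (G (xs ! 0) q)) y)"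
proof -
  \<comment> \<open>The search bounds as seen under one, two and three binders: the table code and
    up to two quantified points.\<close>
  note w1 = computable_weaken[OF W] computable_weaken[OF b] computable_weaken[OF U] computable_weaken[OF V]
  note w2 = w1[THEN computable_weaken]
  note w3 = w2[THEN computable_weaken]
  show ?thesis
    unfolding table_conjugates_def
    by (intro decidable_bex decidable_ball decidable_conj decidable_imp decidable_eq decidable_less decidable_le
        N w1 w2 w3 computable_table_map computable_add computable_mod
        computable_const computable_nth computable_drop computable_drop2 computable_drop3
        computable2_app[OF F] computable2_app[OF G]) simp_all
qed

theorem theorem1:
  fixes n :: nat
    and gs :: "(nat \<times> nat \<Rightarrow> nat \<times> nat) list"
    and ts :: "(nat \<times> nat \<Rightarrow> nat \<times> nat) list"
  assumes "n \<ge> 2"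
    and "generates gs (houghton n)"
    and "generates ts (houghton_ext n)"
  shows "\<exists>f. total_rec 1 f \<and>
           (\<forall>wr wa wb. valid_word ts wr \<and> valid_word gs wa \<and> valid_word gs wb \<longrightarrow>
              (f [list_encode [list_encode wr, list_encode wa, list_encode wb]] = 0
                 \<longleftrightarrow> twisted_conj n (eval_word ts wr) (eval_word gs wa) (eval_word gs wb)))"
proof -
  have n: "n > 0" using assms(1) by simp
  have "\<And>g. g \<in> set gs \<Longrightarrow> admissible n g"
    using assms(2) admissible_houghton[OF n] unfolding generates_def by blast
  then obtain c F where F: "computable2 F" and cF: "\<And>w. valid_word gs w \<Longrightarrow> eval_word gs w \<in> SymX n
       \<and> quasi_periodic n (c * list_encode w) (nat_map n (eval_word gs w))
       \<and> F (list_encode w) = nat_map n (eval_word gs w)"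
    using word_evaluation[OF n] by metis
  have "\<And>g. g \<in> set ts \<Longrightarrow> admissible n g"
    using assms(3) admissible_houghton_ext[OF n] unfolding generates_def by blast
  then obtain c' G where G: "computable2 G" and cG: "\<And>w. valid_word ts w \<Longrightarrow> eval_word ts w \<in> SymX n
       \<and> quasi_periodic n (c' * list_encode w) (nat_map n (eval_word ts w))
       \<and> G (list_encode w) = nat_map n (eval_word ts w)"
    using word_evaluation[OF n] by metis
  \<comment> \<open>Entries 0, 1 and 2 of \<open>xs\<close> are the codes for \<open>\<rho>\<close>,
    \<open>a\<close> and \<open>b\<close>. Adding the codes of \<open>a\<close> and \<open>b\<close>
    gives one displacement bound valid for both \<open>a \<circ> \<rho>\<close> and
    \<open>b \<circ> \<rho>\<close>.\<close>
  define K where "K xs = c * (xs ! 1 + xs ! 2) + c' * xs ! 0" for xs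
  define W where "W xs = width n (K xs)" for xs
  define b where "b xs = 2 * W xs + n" for xs
  define U where "U xs = b xs + W xs + 2 * n + K xs" for xs
  define V where "V xs = U xs + W xs + n" for xs
  define P where "P xs \<longleftrightarrow> (\<exists>y<b xs ^ (W xs + n). table_conjugates n (W xs) (b xs) (U xs) (V xs)
      (\<lambda>q. F (xs ! 1) (G (xs ! 0) q)) (\<lambda>q. F (xs ! 2) (G (xs ! 0) q)) y)" for xs
  have K: "computable 3 K" unfolding K_def
    by (intro computable_add computable_mult computable_const computable_nth) simp_all
  have W: "computable 3 W" unfolding W_def by (rule computable_width[OF K])
  have b: "computable 3 b" unfolding b_def by (intro computable_add computable_mult computable_const W)
  have U: "computable 3 U" unfolding U_def by (intro computable_add computable_mult computable_const b W K)
  have V: "computable 3 V" unfolding V_def by (intro computable_add computable_const U W)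
  have "computable 3 (\<lambda>xs. b xs ^ (W xs + n))"
    by (intro computable_power computable_add computable_const b W)
  then have "decidable 3 P"
    unfolding P_def using W b U V by (rule decidable_table_search[OF F G])
  \<comment> \<open>The answer yes is to be 0, whereas \<open>of_bool\<close> encodes truth as
    1.\<close>
  then have notP: "computable 3 (\<lambda>xs. of_bool (\<not> P xs))"
    using decidable_not unfolding decidable_def by blast
  \<comment> \<open>Decodes a list of three entries, with one predecessor for each list
    cell.\<close>
  let ?args = "[\<lambda>xs. fst (prod_decode (xs ! 0 - 1)),
     \<lambda>xs. fst (prod_decode (snd (prod_decode (xs ! 0 - 1)) - 1)),
     \<lambda>xs. fst (prod_decode (snd (prod_decode (snd (prod_decode (xs ! 0 - 1)) - 1)) - 1))]"
  have "computable 1 (\<lambda>xs. (\<lambda>xs. of_bool (\<not> P xs)) (map (\<lambda>f. f xs) ?args))"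
  proof (rule computable_compose)
    show "computable (length ?args) (\<lambda>xs. of_bool (\<not> P xs))" using notP by (simp add: numeral_3_eq_3)
    fix h assume "h \<in> set ?args"
    then show "computable 1 h"
      by (auto intro!: computable_fst_decode computable_snd_decode computable_diff computable_const computable_nth)
  qed
  then obtain f where f: "total_rec 1 f"
    "\<And>xs. length xs = 1 \<Longrightarrow> f xs = of_bool (\<not> P (map (\<lambda>f. f xs) ?args))"
    unfolding computable_def by blast
  have "f [list_encode [list_encode wr, list_encode wa, list_encode wb]] = 0
      \<longleftrightarrow> twisted_conj n (eval_word ts wr) (eval_word gs wa) (eval_word gs wb)"
    if v: "valid_word ts wr" "valid_word gs wa" "valid_word gs wb" for wr wa wb
  proof -
    let ?xs = "[list_encode wr, list_encode wa, list_encode wb]"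
    let ?A = "nat_map n (eval_word gs wa) \<circ> nat_map n (eval_word ts wr)"
    let ?B = "nat_map n (eval_word gs wb) \<circ> nat_map n (eval_word ts wr)"
    have "f [list_encode ?xs] = 0 \<longleftrightarrow> P ?xs" by (simp add: f(2))
    also have "\<dots> \<longleftrightarrow> (\<exists>x. eventual_translation n x \<and> (\<forall>q. x (?A q) = ?B (x q)))"
    proof -
      have qp: "quasi_periodic n (K ?xs) (nat_map n (eval_word gs w) \<circ> nat_map n (eval_word ts wr))"
        if w: "valid_word gs w" "list_encode w \<le> list_encode wa + list_encode wb" for w
      proof (rule quasi_periodic_mono[OF quasi_periodic_comp])
        show "quasi_periodic n (c * list_encode w) (nat_map n (eval_word gs w))" using cF w by blast
        show "quasi_periodic n (c' * list_encode wr) (nat_map n (eval_word ts wr))" using cG v by blast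
        have "c * list_encode w \<le> c * (list_encode wa + list_encode wb)" using w(2) by (rule mult_le_mono2)
        moreover have "K ?xs = c * (list_encode wa + list_encode wb) + c' * list_encode wr"
          by (simp add: K_def)
        ultimately show "c * list_encode w + c' * list_encode wr \<le> K ?xs" by linarith
      qed
      have "(\<lambda>q. F (?xs ! 1) (G (?xs ! 0) q)) = ?A" "(\<lambda>q. F (?xs ! 2) (G (?xs ! 0) q)) = ?B"
        using cF cG v by (auto simp: fun_eq_iff)
      then show ?thesis
        unfolding P_def
        using conjugate_iff_table[OF n qp[OF v(2)] qp[OF v(3)] W_def b_def U_def V_def] by simp
    qed
    also have "\<dots> \<longleftrightarrow> twisted_conj n (eval_word ts wr) (eval_word gs wa) (eval_word gs wb)"
      using twisted_conj_iff[OF n, of "eval_word ts wr" "eval_word gs wa" "eval_word gs wb"] cF cG v by simp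
    finally show ?thesis .
  qed
  then show ?thesis using f(1) by blast
qed

end
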